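(* Let $\mathcal{A}$ be a properly infinite von Neumann algebra acting on a Hilbert space $H$ and let $F\in\mathcal{A}$. If $F$ is generalized $\mathcal{A}$-Browder, then $F$ is $\mathcal{A}$-Fredholm.
   Context: For closed subspaces, $H=M\tilde\oplus N$ means $M\cap N=\{0\}$ and $M+N=H$ (not necessarily orthogonal). For a closed subspace $L$ of $H$, $P_L$ is the orthogonal projection onto $L$. A projection of $\mathcal{A}$ is finite if it is not Murray–von Neumann equivalent in $\mathcal{A}$ to any of its proper subprojections; $\mathrm{Proj}_0(\mathcal{A})$ is the set of finite projections of $\mathcal{A}$. $F\in\mathcal{A}$ is generalized $\mathcal{A}$-Browder if there is a decomposition $H=M\tilde\oplus N$ into closed subspaces with respect to which (on both domain and codomain) $F$ has the matrix $\begin{pmatrix}F_1&0\\0&F_4\end{pmatrix}$ where $F_1:M\to M$ is an isomorphism, and such that $P_N\in\mathrm{Proj}_0(\mathcal{A})$. $T\in\mathcal{A}$ is $\mathcal{A}$-Fredholm (in the sense of Breuer) if $P_{\ker T}\in\mathrm{Proj}_0(\mathcal{A})$ and there is $E\in\mathrm{Proj}_0(\mathcal{A})$ with $\operatorname{Im}(I-E)\subseteq\operatorname{Im}T$. *)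

theory Defs
  imports "HOL-Analysis.Analysis"
begin

section \<open>Complex Hilbert spaces\<close>

text \<open>
  The underlying real structure is the one of the library: the real inner product is the real part
  of the complex one, so norm and topology are those of the complex inner product. The complex
  inner product is conjugate-linear in its first argument and linear in its second one.
\<close>

class chilbert_space = real_inner + banach +
  fixes scaleC :: "complex \<Rightarrow> 'a \<Rightarrow> 'a"  (infixr \<open>*\<^sub>C\<close> 75)
    and cinner :: "'a \<Rightarrow> 'a \<Rightarrow> complex"
  assumes scaleC_add_right: "c *\<^sub>C (x + y) = c *\<^sub>C x + c *\<^sub>C y"
    and scaleC_add_left: "(c + d) *\<^sub>C x = c *\<^sub>C x + d *\<^sub>C x"
    and scaleC_scaleC: "c *\<^sub>C (d *\<^sub>C x) = (c * d) *\<^sub>C x"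
    and scaleC_of_real: "complex_of_real r *\<^sub>C x = r *\<^sub>R x"
    and cinner_commute: "cinner x y = cnj (cinner y x)"
    and cinner_add_right: "cinner x (y + z) = cinner x y + cinner x z"
    and cinner_scaleC_right: "cinner x (c *\<^sub>C y) = c * cinner x y"
    and Re_cinner: "Re (cinner x y) = inner x y"

instantiation complex :: chilbert_space
begin

definition "scaleC_complex c (x::complex) = c * x"
definition "cinner_complex x (y::complex) = cnj x * y"

instance
  by standard
    (simp_all add: scaleC_complex_def cinner_complex_def algebra_simps scaleR_conv_of_real
      inner_complex_def)

end

definition csubspace :: "'a::chilbert_space set \<Rightarrow> bool"
  where "csubspace L \<longleftrightarrow> 0 \<in> L \<and> (\<forall>x\<in>L. \<forall>y\<in>L. x + y \<in> L) \<and> (\<forall>c. \<forall>x\<in>L. c *\<^sub>C x \<in> L)"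

definition closed_csubspace :: "'a::chilbert_space set \<Rightarrow> bool"
  where "closed_csubspace L \<longleftrightarrow> csubspace L \<and> closed L"

text \<open>The decomposition \<open>H = M \<oplus> N\<close> into closed subspaces, not necessarily orthogonal.\<close>

definition topological_direct_sum :: "'a::chilbert_space set \<Rightarrow> 'a set \<Rightarrow> bool"
  where "topological_direct_sum M N \<longleftrightarrow>
    closed_csubspace M \<and> closed_csubspace N \<and> M \<inter> N = {0} \<and> {m + n |m n. m \<in> M \<and> n \<in> N} = UNIV"


section \<open>Bounded operators and orthogonal projections\<close>

text \<open>
  The library type \<open>'a \<Rightarrow>\<^sub>L 'a\<close> consists of the real-linear bounded operators; \<open>cbounded_ops\<close> is the
  algebra of all bounded complex-linear operators on the Hilbert space.
\<close>

definition cbounded_ops :: "('a::chilbert_space \<Rightarrow>\<^sub>L 'a) set"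
  where "cbounded_ops = {T. \<forall>c x. blinfun_apply T (c *\<^sub>C x) = c *\<^sub>C blinfun_apply T x}"

definition is_adjoint :: "('a::chilbert_space \<Rightarrow>\<^sub>L 'a) \<Rightarrow> ('a \<Rightarrow>\<^sub>L 'a) \<Rightarrow> bool"
  where "is_adjoint T S \<longleftrightarrow>
    (\<forall>x y. cinner (blinfun_apply T x) y = cinner x (blinfun_apply S y))"

definition is_orth_proj :: "'a::chilbert_space set \<Rightarrow> ('a \<Rightarrow>\<^sub>L 'a) \<Rightarrow> bool"
  where "is_orth_proj L P \<longleftrightarrow>
    (\<forall>x. blinfun_apply P x \<in> L \<and> (\<forall>y\<in>L. cinner y (x - blinfun_apply P x) = 0))"

text \<open>Well-defined for closed subspaces only; see \<open>is_orth_proj_orth_proj\<close> below.\<close>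

definition orth_proj :: "'a::chilbert_space set \<Rightarrow> ('a \<Rightarrow>\<^sub>L 'a)"
  where "orth_proj L = (THE P. is_orth_proj L P)"

lemma csubspace_scaleR: "csubspace L \<Longrightarrow> x \<in> L \<Longrightarrow> r *\<^sub>R x \<in> L"
  unfolding csubspace_def by (metis scaleC_of_real)

lemma csubspace_add: "csubspace L \<Longrightarrow> x \<in> L \<Longrightarrow> y \<in> L \<Longrightarrow> x + y \<in> L"
  by (simp add: csubspace_def)

lemma csubspace_diff: "csubspace L \<Longrightarrow> x \<in> L \<Longrightarrow> y \<in> L \<Longrightarrow> x - y \<in> L"
  using csubspace_scaleR[of L y "-1"] unfolding csubspace_def
  by (metis add_uminus_conv_diff scaleR_minus1_left)

lemma csubspace_orthogonal_iff:
  assumes "csubspace L"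
  shows "(\<forall>y\<in>L. cinner y x = 0) \<longleftrightarrow> (\<forall>y\<in>L. inner y x = 0)"
proof
  assume "\<forall>y\<in>L. cinner y x = 0"
  then show "\<forall>y\<in>L. inner y x = 0"
    by (metis Re_cinner zero_complex.sel(1))
next
  assume *: "\<forall>y\<in>L. inner y x = 0"
  show "\<forall>y\<in>L. cinner y x = 0"
  proof
    fix y assume y: "y \<in> L"
    then have "\<i> *\<^sub>C y \<in> L"
      using assms by (simp add: csubspace_def)
    then have "Re (cinner x (\<i> *\<^sub>C y)) = 0"
      using * by (simp add: Re_cinner inner_commute[of x])
    then have "Im (cinner x y) = 0"
      by (simp add: cinner_scaleC_right)
    moreover have "Re (cinner x y) = 0"
      using * y by (simp add: Re_cinner inner_commute[of x])
    ultimately show "cinner y x = 0"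
      by (subst cinner_commute) (simp add: complex_eq_iff)
  qed
qed

lemma csubspace_nearest_point:
  fixes L :: "'a::chilbert_space set"
  assumes L: "csubspace L" "closed L"
  obtains p where "p \<in> L" "\<And>y. y \<in> L \<Longrightarrow> dist x p \<le> dist x y"
proof -
  define d where "d = infdist x L"
  have ne: "L \<noteq> {}" and d0: "0 \<le> d"
    using L by (auto simp: csubspace_def d_def infdist_nonneg)
  have le: "d \<le> dist x y" if "y \<in> L" for y
    using that by (simp add: d_def infdist_le)
  have "\<exists>y\<in>L. dist x y < d + 1 / real (Suc n)" for n
  proof (rule ccontr)
    assume "\<not> ?thesis"
    then have "d + 1 / real (Suc n) \<le> infdist x L"
      using ne by (auto simp: infdist_def not_less intro!: cINF_greatest)
    then show False
      by (simp add: d_def)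
  qed
  then obtain s where s: "\<And>n. s n \<in> L" "\<And>n. dist x (s n) < d + 1 / real (Suc n)"
    by metis
  have lim: "(\<lambda>n. dist x (s n)) \<longlonglongrightarrow> d"
  proof (rule tendsto_sandwich[of "\<lambda>_. d" _ _ "\<lambda>n. d + 1 / real (Suc n)"])
    have "(\<lambda>n. d + 1 / real (Suc n)) \<longlonglongrightarrow> d + 0"
      by (intro tendsto_intros LIMSEQ_Suc lim_1_over_n)
    then show "(\<lambda>n. d + 1 / real (Suc n)) \<longlonglongrightarrow> d" by simp
  next
    show "\<forall>\<^sub>F n in sequentially. dist x (s n) \<le> d + 1 / real (Suc n)"
      by (intro always_eventually allI less_imp_le s(2))
  qed (use le s in auto)
  have par: "(dist (s m) (s n))\<^sup>2 \<le> 2 * (dist x (s m))\<^sup>2 + 2 * (dist x (s n))\<^sup>2 - 4 * d\<^sup>2" for m n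
  proof -
    have "(1/2) *\<^sub>R (s m + s n) \<in> L"
      by (intro csubspace_add csubspace_scaleR L s)
    then have "d\<^sup>2 \<le> (dist x ((1/2) *\<^sub>R (s m + s n)))\<^sup>2"
      using le d0 by (intro power_mono) auto
    moreover have "(dist (s m) (s n))\<^sup>2 + 4 * (dist x ((1/2) *\<^sub>R (s m + s n)))\<^sup>2
        = 2 * (dist x (s m))\<^sup>2 + 2 * (dist x (s n))\<^sup>2"
    proof -
      define a b where ab: "a = x - s m" "b = x - s n"
      have eq: "s m - s n = b - a" "x - (1/2) *\<^sub>R (s m + s n) = (1/2) *\<^sub>R (a + b)"
        unfolding ab by (simp_all add: algebra_simps flip: scaleR_add_left)
      show ?thesis
        unfolding dist_norm eq power2_norm_eq_inner ab[symmetric]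
        by (simp add: inner_diff_left inner_diff_right inner_add_left inner_add_right
            inner_commute[of b a] field_simps)
    qed
    ultimately show ?thesis by linarith
  qed
  have "Cauchy s"
  proof (rule metric_CauchyI)
    fix e :: real assume e: "0 < e"
    have "(\<lambda>n. (dist x (s n))\<^sup>2) \<longlonglongrightarrow> d\<^sup>2"
      by (intro tendsto_intros lim)
    then have "eventually (\<lambda>n. (dist x (s n))\<^sup>2 < d\<^sup>2 + e\<^sup>2 / 4) sequentially"
      by (rule order_tendstoD) (use e in simp)
    then obtain N where N: "\<And>n. n \<ge> N \<Longrightarrow> (dist x (s n))\<^sup>2 < d\<^sup>2 + e\<^sup>2 / 4"
      by (auto simp: eventually_sequentially)
    have "dist (s m) (s n) < e" if "m \<ge> N" "n \<ge> N" for m n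
    proof -
      have "(dist (s m) (s n))\<^sup>2 < e\<^sup>2"
        using par[of m n] N[OF that(1)] N[OF that(2)] by linarith
      then show ?thesis
        using e by (meson less_imp_le power_less_imp_less_base)
    qed
    then show "\<exists>N. \<forall>m\<ge>N. \<forall>n\<ge>N. dist (s m) (s n) < e" by blast
  qed
  then obtain p where p: "s \<longlonglongrightarrow> p"
    using Cauchy_convergent_iff convergent_def by blast
  have "p \<in> L"
    using L(2) s(1) p closed_sequentially by blast
  moreover have "dist x p = d"
    using LIMSEQ_unique[OF tendsto_dist[OF tendsto_const p] lim] .
  ultimately show ?thesis
    using that le by simp
qed

lemma csubspace_orthogonal_decomposition:
  fixes L :: "'a::chilbert_space set"
  assumes L: "csubspace L" "closed L"
  obtains p where "p \<in> L" "\<And>y. y \<in> L \<Longrightarrow> cinner y (x - p) = 0"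
proof -
  obtain p where p: "p \<in> L" "\<And>y. y \<in> L \<Longrightarrow> dist x p \<le> dist x y"
    using csubspace_nearest_point[OF L] by blast
  have "inner y (x - p) = 0" if y: "y \<in> L" for y
  proof (cases "y = 0")
    case False
    define t where "t = inner y (x - p) / inner y y"
    have "p + t *\<^sub>R y \<in> L"
      by (intro csubspace_add csubspace_scaleR L p y)
    then have "(norm (x - p))\<^sup>2 \<le> (norm ((x - p) - t *\<^sub>R y))\<^sup>2"
      using p(2)[of "p + t *\<^sub>R y"] by (simp add: dist_norm algebra_simps)
    also have "\<dots> = (norm (x - p))\<^sup>2 - 2 * t * inner y (x - p) + t\<^sup>2 * inner y y"
      unfolding power2_norm_eq_inner
      by (simp add: inner_diff_left inner_diff_right inner_commute[of x y] inner_commute[of p y]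
          inner_commute[of p x] algebra_simps power2_eq_square)
    also have "t\<^sup>2 * inner y y = t * inner y (x - p)"
      using False by (simp add: t_def power2_eq_square)
    finally have "(inner y (x - p))\<^sup>2 / inner y y \<le> 0"
      by (simp add: t_def power2_eq_square)
    moreover have "0 < inner y y" using False by simp
    ultimately show ?thesis
      by (simp add: divide_le_0_iff)
  qed simp
  then show ?thesis
    using that[OF p(1)] csubspace_orthogonal_iff[OF L(1), of "x - p"] by blast
qed

lemma is_orth_proj_ex1:
  fixes L :: "'a::chilbert_space set"
  assumes "closed_csubspace L"
  shows "\<exists>!P. is_orth_proj L P"
proof -
  have L: "csubspace L" "closed L"
    using assms by (auto simp: closed_csubspace_def)
  have "\<forall>x. \<exists>p. p \<in> L \<and> (\<forall>y\<in>L. inner y (x - p) = 0)"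
  proof
    fix x
    obtain p where "p \<in> L" "\<And>y. y \<in> L \<Longrightarrow> cinner y (x - p) = 0"
      using csubspace_orthogonal_decomposition[OF L] by blast
    then show "\<exists>p. p \<in> L \<and> (\<forall>y\<in>L. inner y (x - p) = 0)"
      using csubspace_orthogonal_iff[OF L(1), of "x - p"] by blast
  qed
  then obtain f where f: "\<And>x. f x \<in> L" "\<And>x y. y \<in> L \<Longrightarrow> inner y (x - f x) = 0"
    by metis
  have inner_f: "inner y (f x) = inner y x" if "y \<in> L" for x y
    using f(2)[OF that, of x] by (simp add: inner_diff_right)
  have uniq: "p = f x" if "p \<in> L" "\<And>y. y \<in> L \<Longrightarrow> inner y (x - p) = 0" for p x
  proof -
    have "p - f x \<in> L" using L f that csubspace_diff by blast
    then have "inner (p - f x) (x - f x) = 0" "inner (p - f x) (x - p) = 0"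
      using f that by blast+
    then have "inner (p - f x) (p - f x) = 0"
      by (simp add: inner_diff_right)
    then show ?thesis by simp
  qed
  have "bounded_linear f"
  proof (rule bounded_linear_intro[where K = 1])
    fix x y
    show "f (x + y) = f x + f y"
      by (rule uniq[symmetric])
        (simp_all add: f(1) csubspace_add[OF L(1)] inner_add_right inner_diff_right inner_f)
    show "f (r *\<^sub>R x) = r *\<^sub>R f x" for r
      by (rule uniq[symmetric])
        (simp_all add: f(1) csubspace_scaleR[OF L(1)] inner_diff_right inner_f)
    have "inner (f x) x = inner (f x) (f x)"
      by (simp add: inner_f f(1))
    then have "norm (f x) * norm (f x) \<le> norm (f x) * norm x"
      by (metis norm_cauchy_schwarz power2_eq_square power2_norm_eq_inner)
    then show "norm (f x) \<le> norm x * 1"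
      by (cases "norm (f x) = 0") (auto simp: mult_le_cancel_left)
  qed
  then have "blinfun_apply (Blinfun f) = f"
    by (rule bounded_linear_Blinfun_apply)
  then have "is_orth_proj L (Blinfun f)"
    by (simp add: is_orth_proj_def csubspace_orthogonal_iff[OF L(1)] f)
  moreover have "P = Blinfun f" if "is_orth_proj L P" for P
  proof (rule blinfun_eqI)
    fix x
    show "blinfun_apply P x = blinfun_apply (Blinfun f) x"
      unfolding \<open>blinfun_apply (Blinfun f) = f\<close>
      using that by (intro uniq) (simp_all add: is_orth_proj_def csubspace_orthogonal_iff[OF L(1)])
  qed
  ultimately show ?thesis by blast
qed

lemma is_orth_proj_orth_proj: "closed_csubspace L \<Longrightarrow> is_orth_proj L (orth_proj L)"
  unfolding orth_proj_def by (rule theI'[OF is_orth_proj_ex1])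


section \<open>Von Neumann algebras\<close>

definition commutant :: "('a::chilbert_space \<Rightarrow>\<^sub>L 'a) set \<Rightarrow> ('a \<Rightarrow>\<^sub>L 'a) set"
  where "commutant S = {T \<in> cbounded_ops. \<forall>A\<in>S. T o\<^sub>L A = A o\<^sub>L T}"

text \<open>
  A von Neumann algebra on \<open>H\<close> is a \<open>*\<close>-subalgebra of \<open>B(H)\<close> that equals its double commutant. The
  closure properties of a unital subalgebra need not be listed: every commutant has them.
\<close>

definition von_neumann_algebra :: "('a::chilbert_space \<Rightarrow>\<^sub>L 'a) set \<Rightarrow> bool"
  where "von_neumann_algebra \<A> \<longleftrightarrow>
    \<A> \<subseteq> cbounded_ops \<and>
    (\<forall>T\<in>\<A>. \<exists>S\<in>\<A>. is_adjoint T S) \<and>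
    commutant (commutant \<A>) = \<A>"

definition Proj :: "('a::chilbert_space \<Rightarrow>\<^sub>L 'a) set \<Rightarrow> ('a \<Rightarrow>\<^sub>L 'a) set"
  where "Proj \<A> = {P \<in> \<A>. P o\<^sub>L P = P \<and> is_adjoint P P}"

definition mvn_equiv ::
    "('a::chilbert_space \<Rightarrow>\<^sub>L 'a) set \<Rightarrow> ('a \<Rightarrow>\<^sub>L 'a) \<Rightarrow> ('a \<Rightarrow>\<^sub>L 'a) \<Rightarrow> bool"
  where "mvn_equiv \<A> P Q \<longleftrightarrow> (\<exists>V\<in>\<A>. \<exists>W\<in>\<A>. is_adjoint V W \<and> W o\<^sub>L V = P \<and> V o\<^sub>L W = Q)"

definition proper_subprojection :: "('a::chilbert_space \<Rightarrow>\<^sub>L 'a) \<Rightarrow> ('a \<Rightarrow>\<^sub>L 'a) \<Rightarrow> bool"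
  where "proper_subprojection Q P \<longleftrightarrow> range (blinfun_apply Q) \<subset> range (blinfun_apply P)"

definition Proj\<^sub>0 :: "('a::chilbert_space \<Rightarrow>\<^sub>L 'a) set \<Rightarrow> ('a \<Rightarrow>\<^sub>L 'a) set"
  where "Proj\<^sub>0 \<A> = {P \<in> Proj \<A>. \<not> (\<exists>Q \<in> Proj \<A>. proper_subprojection Q P \<and> mvn_equiv \<A> P Q)}"

text \<open>Properly infinite: the only finite central projection is zero.\<close>

definition properly_infinite :: "('a::chilbert_space \<Rightarrow>\<^sub>L 'a) set \<Rightarrow> bool"
  where "properly_infinite \<A> \<longleftrightarrow> (\<forall>P \<in> Proj \<A> \<inter> commutant \<A>. P \<in> Proj\<^sub>0 \<A> \<longrightarrow> P = 0)"


section \<open>Generalized Browder and Fredholm operators\<close>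

text \<open>
  The matrix of \<open>F\<close> with respect to \<open>H = M \<oplus> N\<close>, on domain and codomain, is diagonal with entries
  \<open>F1\<close> on \<open>M\<close> and \<open>F4\<close> on \<open>N\<close>; linearity and continuity of the entries follow from those of \<open>F\<close>.
\<close>

definition has_diagonal_matrix ::
    "('a::chilbert_space \<Rightarrow>\<^sub>L 'a) \<Rightarrow> 'a set \<Rightarrow> 'a set \<Rightarrow> ('a \<Rightarrow> 'a) \<Rightarrow> ('a \<Rightarrow> 'a) \<Rightarrow> bool"
  where "has_diagonal_matrix F M N F1 F4 \<longleftrightarrow>
    F1 ` M \<subseteq> M \<and> F4 ` N \<subseteq> N \<and> (\<forall>m\<in>M. \<forall>n\<in>N. blinfun_apply F (m + n) = F1 m + F4 n)"

text \<open>
  Isomorphism of the Banach space \<open>M\<close>: bijective with bounded inverse. As \<open>F1\<close> is linear on \<open>M\<close>, this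
  says that it is a homeomorphism of \<open>M\<close>.
\<close>

definition generalized_Browder ::
    "('a::chilbert_space \<Rightarrow>\<^sub>L 'a) set \<Rightarrow> ('a \<Rightarrow>\<^sub>L 'a) \<Rightarrow> bool"
  where "generalized_Browder \<A> F \<longleftrightarrow>
    F \<in> \<A> \<and>
    (\<exists>M N F1 F4. topological_direct_sum M N \<and> has_diagonal_matrix F M N F1 F4 \<and>
      (\<exists>G. homeomorphism M M F1 G) \<and> orth_proj N \<in> Proj\<^sub>0 \<A>)"

definition Fredholm :: "('a::chilbert_space \<Rightarrow>\<^sub>L 'a) set \<Rightarrow> ('a \<Rightarrow>\<^sub>L 'a) \<Rightarrow> bool"
  where "Fredholm \<A> T \<longleftrightarrow>
    T \<in> \<A> \<and>
    orth_proj {x. blinfun_apply T x = 0} \<in> Proj\<^sub>0 \<A> \<and>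
    (\<exists>E \<in> Proj\<^sub>0 \<A>. range (blinfun_apply (id_blinfun - E)) \<subseteq> range (blinfun_apply T))"

end

theory Submission
  imports Defs
begin

text \<open>
  Let \<open>P\<close> be the projection onto \<open>N\<close> and \<open>Q = I - P\<close>. The subspace \<open>M\<close> need not be affiliated with
  the algebra (for \<open>F = I\<close> every closed complement of \<open>N\<close> is allowed), so neither orthogonal nor
  oblique projections attached to \<open>M\<close> are available. What survives is that \<open>F\<close> preserves \<open>N\<close> and
  induces a bijection of \<open>H / N\<close>. This can be expressed inside the algebra: the compression \<open>Q F Q\<close>
  is bijective on the range of \<open>Q\<close>, hence bounded below there by the bounded inverse theorem.

  The kernel of \<open>F\<close> lies in \<open>N\<close>, and a subprojection of a finite projection is finite. For the range,
  consider \<open>L = F (Q H)\<close>. It is closed, and it is a graph over \<open>Q H\<close>: the map \<open>Q\<close> takes \<open>L\<close>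
  bijectively onto \<open>Q H\<close>, with a bounded inverse. Let \<open>E\<close> be the projection onto the orthogonal
  complement of \<open>L\<close>, which is the kernel of \<open>Q F*\<close>; therefore \<open>E\<close> belongs to the algebra, and \<open>I - E\<close>
  has its range \<open>L\<close> inside that of \<open>F\<close>. A vector orthogonal to a bounded graph over \<open>Q H\<close> is controlled
  by its component in \<open>P H\<close>, so \<open>P\<close> is bounded below on the range of \<open>E\<close>. The polar
  decomposition of \<open>P E\<close> then turns this into a Murray-von Neumann equivalence of \<open>E\<close> with a
  subprojection of \<open>P\<close>, and \<open>E\<close> is finite.

  The polar decomposition needs no spectral theory here. With \<open>B = E Q E\<close>, of norm less than one
  because \<open>P\<close> is bounded below on the range of \<open>E\<close>, it is enough to have a self-adjoint
  \<open>R = (I - B)\<^sup>-\<^sup>1\<^sup>/\<^sup>2\<close> in the algebra that commutes with \<open>E\<close>. It is obtained from two applications of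
  the Banach fixed point theorem in the norm-closed algebra of all operators commuting with the
  commutant and with \<open>E\<close>. The lemmas \<open>inverse_square_root_in_commutant\<close>,
  \<open>finite_projection_bounded_below\<close> and \<open>Fredholm_if_bijective_modulo_finite\<close> carry the argument.
\<close>


section \<open>The bounded inverse theorem\<close>

text \<open>
  The Baire category argument of the open mapping theorem: the closures of the images of the balls
  of integer radius cover the space, so one of them contains a ball.
\<close>

lemma approximate_preimages:
  fixes f :: "'a::real_normed_vector \<Rightarrow>\<^sub>L 'b::banach"
  assumes surj: "surj (blinfun_apply f)"
  obtains K where "0 \<le> K"
    "\<And>y. \<exists>x. norm x \<le> K * norm y \<and> norm (y - blinfun_apply f x) \<le> norm y / 2"
proof -
  define W where "W k = closure (blinfun_apply f ` cball 0 (real k))" for k :: nat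
  have "\<exists>k. interior (W k) \<noteq> {}"
  proof (rule ccontr)
    assume "\<not> ?thesis"
    then have "euclidean interior_of \<Union>(range W) = ({} :: 'b set)"
      by (intro Baire_category_alt disjI1 completely_metrizable_space_euclidean)
        (auto simp: W_def)
    moreover have "\<Union>(range W) = UNIV"
    proof -
      have "y \<in> \<Union>(range W)" for y
      proof -
        obtain x where x: "y = blinfun_apply f x"
          using surj by blast
        obtain k :: nat where "norm x \<le> real k"
          using real_arch_simple by blast
        then have "y \<in> W k"
          unfolding W_def x by (intro closure_subset[THEN subsetD] imageI) simp
        then show ?thesis by blast
      qed
      then show ?thesis by blast
    qed
    ultimately show False by simp
  qed
  then obtain k y0 r where r: "0 < r" "ball y0 r \<subseteq> W k"
    by (meson all_not_in_conv mem_interior)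
  have W_approx: "\<exists>x. norm x \<le> real k \<and> dist (blinfun_apply f x) z < e"
    if z: "z \<in> W k" and e: "0 < e" for z e
  proof -
    obtain w where w: "w \<in> blinfun_apply f ` cball 0 (real k)" "dist w z < e"
      using z e unfolding W_def closure_approachable by blast
    from w(1) obtain x where "w = blinfun_apply f x" "x \<in> cball 0 (real k)" ..
    with w(2) show ?thesis by auto
  qed
  \<comment> \<open>Differences of points near the centre and near a point of the ball move the ball to the origin.\<close>
  have near: "\<exists>x. norm x \<le> 2 * real k \<and> norm (y - blinfun_apply f x) < e"
    if y: "norm y < r" and e: "0 < e" for y e
  proof -
    have "y0 + y \<in> W k" "y0 \<in> W k"
      using r y by (auto simp: subset_eq dist_norm)
    then obtain a b where ab: "norm a \<le> real k" "norm b \<le> real k"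
      "dist (blinfun_apply f a) (y0 + y) < e / 2" "dist (blinfun_apply f b) y0 < e / 2"
      using W_approx half_gt_zero[OF e] by meson
    have "norm (y - blinfun_apply f (a - b))
        = norm ((blinfun_apply f b - y0) - (blinfun_apply f a - (y0 + y)))"
      by (simp add: blinfun.diff_right algebra_simps)
    also have "\<dots> < e"
      using ab(3,4) norm_triangle_ineq4[of "blinfun_apply f b - y0" "blinfun_apply f a - (y0 + y)"]
      by (simp add: dist_norm)
    finally show ?thesis
      using ab(1,2) norm_triangle_ineq4[of a b] by (intro exI[of _ "a - b"]) auto
  qed
  define K where "K = 4 * real k / r"
  have "\<exists>x. norm x \<le> K * norm y \<and> norm (y - blinfun_apply f x) \<le> norm y / 2" for y
  proof (cases "y = 0")
    case True
    then show ?thesis by (intro exI[of _ 0]) (simp add: blinfun.zero_right)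
  next
    case False
    define t where "t = r / (2 * norm y)"
    have t: "0 < t" using False r by (simp add: t_def)
    have "norm (t *\<^sub>R y) < r" using False r by (simp add: t_def)
    then obtain x where x: "norm x \<le> 2 * real k"
      "norm (t *\<^sub>R y - blinfun_apply f x) < t * norm y / 2"
      using near[of "t *\<^sub>R y" "t * norm y / 2"] t False by auto
    have "y - blinfun_apply f (x /\<^sub>R t) = (t *\<^sub>R y - blinfun_apply f x) /\<^sub>R t"
      using t by (simp add: blinfun.scaleR_right scaleR_diff_right)
    then have "norm (y - blinfun_apply f (x /\<^sub>R t)) = norm (t *\<^sub>R y - blinfun_apply f x) / t"
      using t by (simp add: divide_inverse mult.commute)
    also have "\<dots> \<le> (t * norm y / 2) / t"
      using x(2) t by (intro divide_right_mono) auto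
    also have "\<dots> = norm y / 2"
      using t by simp
    finally have "norm (y - blinfun_apply f (x /\<^sub>R t)) \<le> norm y / 2" .
    moreover have "norm (x /\<^sub>R t) \<le> K * norm y"
    proof -
      have "norm (x /\<^sub>R t) = norm x / t"
        using t by (simp add: divide_inverse mult.commute)
      also have "\<dots> \<le> 2 * real k / t"
        using x(1) t by (intro divide_right_mono) auto
      also have "\<dots> = K * norm y"
        using r False by (simp add: t_def K_def field_simps)
      finally show ?thesis .
    qed
    ultimately show ?thesis by blast
  qed
  moreover have "0 \<le> K" using r by (simp add: K_def)
  ultimately show ?thesis using that by blast
qed

text \<open>
  Approximate preimages are corrected repeatedly: the error halves at each step, so the corrections
  form a convergent series whose sum is an exact preimage of controlled norm. By injectivity it is the
  only preimage.
\<close>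

theorem bounded_inverse:
  fixes f :: "'a::banach \<Rightarrow>\<^sub>L 'b::banach"
  assumes inj: "inj (blinfun_apply f)" and surj: "surj (blinfun_apply f)"
  obtains c where "0 < c" "\<And>x. c * norm x \<le> norm (blinfun_apply f x)"
proof -
  obtain K where K: "0 \<le> K"
    "\<And>y. \<exists>x. norm x \<le> K * norm y \<and> norm (y - blinfun_apply f x) \<le> norm y / 2"
    using approximate_preimages[OF surj] by blast
  then obtain g where g: "\<And>y. norm (g y) \<le> K * norm y"
    "\<And>y. norm (y - blinfun_apply f (g y)) \<le> norm y / 2"
    by metis
  have bound: "norm x \<le> 2 * K * norm (blinfun_apply f x)" for x
  proof -
    define y where "y n = ((\<lambda>y. y - blinfun_apply f (g y)) ^^ n) (blinfun_apply f x)" for n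
    have y_Suc: "y (Suc n) = y n - blinfun_apply f (g (y n))" for n
      by (simp add: y_def)
    have y_le: "norm (y n) \<le> norm (blinfun_apply f x) * (1/2) ^ n" for n
    proof (induction n)
      case (Suc n)
      then show ?case using g(2)[of "y n"] unfolding y_Suc by simp
    qed (simp add: y_def)
    have geo: "(\<lambda>n. K * norm (blinfun_apply f x) * (1/2) ^ n) sums (K * norm (blinfun_apply f x) * 2)"
      using sums_mult[OF geometric_sums[of "1/2::real"], of "K * norm (blinfun_apply f x)"] by simp
    have "(\<lambda>n. norm (blinfun_apply f x) * (1/2) ^ n) \<longlonglongrightarrow> 0"
      by (rule tendsto_mult_right_zero[OF LIMSEQ_power_zero]) simp
    then have y_lim: "y \<longlonglongrightarrow> 0"
      by (rule Lim_null_comparison[OF always_eventually[OF allI[OF y_le]]])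
    have gy: "norm (g (y n)) \<le> K * norm (blinfun_apply f x) * (1/2) ^ n" for n
      using g(1)[of "y n"] mult_left_mono[OF y_le K(1), of n] by (simp add: mult.assoc)
    have sm: "summable (\<lambda>n. g (y n))"
      by (rule summable_comparison_test'[OF sums_summable[OF geo] gy])
    have "(\<lambda>n. blinfun_apply f (g (y n))) sums (y 0 - 0)"
      using telescope_sums'[OF y_lim] by (simp add: y_Suc)
    moreover have "(\<lambda>n. blinfun_apply f (g (y n))) sums blinfun_apply f (\<Sum>n. g (y n))"
      by (intro bounded_linear.sums[OF blinfun.bounded_linear_right] summable_sums sm)
    ultimately have "blinfun_apply f (\<Sum>n. g (y n)) = blinfun_apply f x"
      using sums_unique2 by (fastforce simp: y_def)
    then have "x = (\<Sum>n. g (y n))"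
      using inj by (simp add: inj_eq)
    also have "norm \<dots> \<le> K * norm (blinfun_apply f x) * 2"
      using norm_suminf_le[OF gy sums_summable[OF geo]] sums_unique[OF geo] by simp
    finally show ?thesis by simp
  qed
  show ?thesis
  proof (rule that[of "1 / (2 * K + 1)"])
    show "0 < 1 / (2 * K + 1)" using K(1) by simp
    show "1 / (2 * K + 1) * norm x \<le> norm (blinfun_apply f x)" for x
    proof -
      have "norm x \<le> (2 * K + 1) * norm (blinfun_apply f x)"
        using add_mono[OF bound[of x] norm_ge_zero[of "blinfun_apply f x"]]
        by (simp add: distrib_right)
      then show ?thesis
        using K(1) by (simp add: field_simps)
    qed
  qed
qed


section \<open>Adjoints and commutants\<close>

lemma Im_cinner: "Im (cinner x y) = inner (\<i> *\<^sub>C x) y"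
  by (simp flip: Re_cinner) (subst (1 2) cinner_commute, simp add: cinner_scaleC_right)

text \<open>
  For a complex-linear operator adjointness is a statement about the real inner product, which
  makes the closedness of the adjoint relation a matter of the continuity of the real inner product.
\<close>

lemma is_adjoint_iff_inner:
  assumes "T \<in> cbounded_ops"
  shows "is_adjoint T S \<longleftrightarrow>
    (\<forall>x y. inner (blinfun_apply T x) y = inner x (blinfun_apply S y))"
proof
  assume "is_adjoint T S"
  then show "\<forall>x y. inner (blinfun_apply T x) y = inner x (blinfun_apply S y)"
    unfolding is_adjoint_def by (metis Re_cinner)
next
  assume *: "\<forall>x y. inner (blinfun_apply T x) y = inner x (blinfun_apply S y)"
  have "\<i> *\<^sub>C blinfun_apply T x = blinfun_apply T (\<i> *\<^sub>C x)" for x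
    using assms by (simp add: cbounded_ops_def)
  then show "is_adjoint T S"
    unfolding is_adjoint_def complex_eq_iff by (simp add: Re_cinner Im_cinner *)
qed

lemma is_adjoint_inner:
  "is_adjoint T S \<Longrightarrow> inner (blinfun_apply T x) y = inner x (blinfun_apply S y)"
  unfolding is_adjoint_def by (metis Re_cinner)

lemma inner_left_zero_imp_zero: "(\<And>y. inner x y = 0) \<Longrightarrow> x = 0"
  using inner_eq_zero_iff[of x] by blast

lemma cinner_eq_0_imp_inner: "cinner x y = 0 \<Longrightarrow> inner x y = 0"
  by (simp flip: Re_cinner)

lemma is_adjoint_sym: "is_adjoint T S \<Longrightarrow> is_adjoint S T"
  unfolding is_adjoint_def by (metis cinner_commute)

lemma is_adjoint_compose:
  "is_adjoint T T' \<Longrightarrow> is_adjoint S S' \<Longrightarrow> is_adjoint (T o\<^sub>L S) (S' o\<^sub>L T')"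
  by (simp add: is_adjoint_def)

lemma cinner_diff_right: "cinner x (y - z) = cinner x y - cinner x z"
  using cinner_add_right[of x "y - z" z] by simp

lemma cinner_add_left: "cinner (x + y) z = cinner x z + cinner y z"
  by (subst (1 2 3) cinner_commute) (simp add: cinner_add_right)

lemma cinner_diff_left: "cinner (x - y) z = cinner x z - cinner y z"
  using cinner_add_left[of "x - y" y z] by simp

lemma is_adjoint_add:
  "is_adjoint T T' \<Longrightarrow> is_adjoint S S' \<Longrightarrow> is_adjoint (T + S) (T' + S')"
  by (simp add: is_adjoint_def blinfun.add_left cinner_add_left cinner_add_right)

lemma is_adjoint_diff:
  "is_adjoint T T' \<Longrightarrow> is_adjoint S S' \<Longrightarrow> is_adjoint (T - S) (T' - S')"
  by (simp add: is_adjoint_def blinfun.diff_left cinner_diff_left cinner_diff_right)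

lemma is_adjoint_id: "is_adjoint id_blinfun id_blinfun"
  by (simp add: is_adjoint_def)

lemma bounded_linear_scaleC: "bounded_linear (scaleC c :: 'a::chilbert_space \<Rightarrow> 'a)"
proof (rule bounded_linear_intro[where K = "cmod c"])
  fix x y :: 'a
  show "c *\<^sub>C (x + y) = c *\<^sub>C x + c *\<^sub>C y"
    by (rule scaleC_add_right)
  show "c *\<^sub>C (r *\<^sub>R x) = r *\<^sub>R (c *\<^sub>C x)" for r
    by (simp add: scaleC_scaleC mult.commute flip: scaleC_of_real)
  have "cinner (c *\<^sub>C x) (c *\<^sub>C x) = (c * cnj c) * cinner x x"
    by (subst cinner_scaleC_right, subst cinner_commute, subst cinner_scaleC_right)
      (simp flip: cinner_commute)
  also have "c * cnj c = complex_of_real ((cmod c)\<^sup>2)"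
    by (rule complex_norm_square[symmetric])
  finally have "(norm (c *\<^sub>C x))\<^sup>2 = (cmod c)\<^sup>2 * (norm x)\<^sup>2"
    unfolding power2_norm_eq_inner[of "c *\<^sub>C x"] power2_norm_eq_inner[of x]
    by (simp flip: Re_cinner)
  then show "norm (c *\<^sub>C x) \<le> norm x * cmod c"
    by (simp add: mult.commute flip: power_mult_distrib)
qed

lemma scaleC_diff_right: "c *\<^sub>C (x - y) = c *\<^sub>C x - c *\<^sub>C (y :: 'a::chilbert_space)"
  by (rule linear_diff[OF bounded_linear.linear[OF bounded_linear_scaleC]])

lemma scaleC_scaleR: "c *\<^sub>C (r *\<^sub>R x) = r *\<^sub>R (c *\<^sub>C (x :: 'a::chilbert_space))"
  by (rule linear_scale[OF bounded_linear.linear[OF bounded_linear_scaleC]])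

lemma commutant_id: "id_blinfun \<in> commutant S"
  by (auto simp: commutant_def cbounded_ops_def intro!: blinfun_eqI)

lemma commutant_apply:
  "T \<in> commutant S \<Longrightarrow> A \<in> S \<Longrightarrow>
    blinfun_apply T (blinfun_apply A x) = blinfun_apply A (blinfun_apply T x)"
  unfolding commutant_def by (metis (mono_tags, lifting) blinfun_apply_blinfun_compose mem_Collect_eq)

lemma commutantI:
  assumes "T \<in> cbounded_ops"
    and "\<And>A x. A \<in> S \<Longrightarrow> blinfun_apply T (blinfun_apply A x) = blinfun_apply A (blinfun_apply T x)"
  shows "T \<in> commutant S"
  using assms by (auto simp: commutant_def intro!: blinfun_eqI)

lemma commutant_cbounded: "T \<in> commutant S \<Longrightarrow> T \<in> cbounded_ops"
  by (simp add: commutant_def)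

lemma commutant_compose: "T \<in> commutant S \<Longrightarrow> U \<in> commutant S \<Longrightarrow> T o\<^sub>L U \<in> commutant S"
  by (rule commutantI) (simp_all add: commutant_apply, simp add: commutant_def cbounded_ops_def)

lemma commutant_add: "T \<in> commutant S \<Longrightarrow> U \<in> commutant S \<Longrightarrow> T + U \<in> commutant S"
  by (rule commutantI)
    (simp_all add: commutant_apply blinfun.bilinear_simps,
      simp add: commutant_def cbounded_ops_def blinfun.bilinear_simps scaleC_add_right)

lemma commutant_diff: "T \<in> commutant S \<Longrightarrow> U \<in> commutant S \<Longrightarrow> T - U \<in> commutant S"
  by (rule commutantI)
    (simp_all add: commutant_apply blinfun.bilinear_simps,
      simp add: commutant_def cbounded_ops_def blinfun.bilinear_simps scaleC_diff_right)

lemma commutant_scaleR: "T \<in> commutant S \<Longrightarrow> r *\<^sub>R T \<in> commutant S"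
  by (rule commutantI)
    (simp_all add: commutant_apply blinfun.bilinear_simps,
      simp add: commutant_def cbounded_ops_def blinfun.bilinear_simps scaleC_scaleR)

lemma closed_commutant: "closed (commutant (S :: ('a::chilbert_space \<Rightarrow>\<^sub>L 'a) set))"
proof -
  have "commutant S = {T. \<forall>c x. blinfun_apply T (c *\<^sub>C x) = c *\<^sub>C blinfun_apply T x} \<inter>
      (\<Inter>A\<in>S. {T. T o\<^sub>L A = A o\<^sub>L T})"
    by (auto simp: commutant_def cbounded_ops_def)
  moreover have "closed {T :: 'a \<Rightarrow>\<^sub>L 'a. \<forall>c x. blinfun_apply T (c *\<^sub>C x) = c *\<^sub>C blinfun_apply T x}"
    by (intro closed_Collect_all closed_Collect_eq
        bounded_linear.continuous_on[OF bounded_linear_scaleC] continuous_intros)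
  moreover have "closed {T. T o\<^sub>L A = A o\<^sub>L T}" for A :: "'a \<Rightarrow>\<^sub>L 'a"
    by (intro closed_Collect_eq
        bounded_bilinear.continuous_on[OF bounded_bilinear_blinfun_compose] continuous_intros)
  ultimately show ?thesis
    by (auto intro!: closed_Int closed_INT)
qed


section \<open>Inverse square roots in a commutant\<close>

lemma closed_selfadjoint_commutant:
  "closed {T \<in> commutant (S :: ('a::chilbert_space \<Rightarrow>\<^sub>L 'a) set). is_adjoint T T}"
proof -
  have "{T \<in> commutant S. is_adjoint T T} = commutant S \<inter>
      {T. \<forall>x y. inner (blinfun_apply T x) y = inner x (blinfun_apply T y)}"
    using commutant_cbounded is_adjoint_iff_inner by blast
  moreover have
    "closed {T :: 'a \<Rightarrow>\<^sub>L 'a. \<forall>x y. inner (blinfun_apply T x) y = inner x (blinfun_apply T y)}"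
    by (intro closed_Collect_all closed_Collect_eq continuous_intros)
  ultimately show ?thesis
    by (simp only: closed_Int[OF closed_commutant])
qed

text \<open>
  Writing the square root of \<open>I - B\<close> as \<open>I - Y\<close> turns \<open>(I - Y)\<^sup>2 = I - B\<close> into the fixed point
  equation \<open>Y = (B + Y\<^sup>2) / 2\<close>. On the ball of radius \<open>norm B < 1\<close> the right-hand side is a
  contraction, and it preserves self-adjointness and the commutant.
\<close>

lemma square_root_in_commutant:
  fixes B :: "'a::chilbert_space \<Rightarrow>\<^sub>L 'a"
  assumes B: "B \<in> commutant S" "is_adjoint B B" "norm B < 1"
  obtains Y where "Y \<in> commutant S" "is_adjoint Y Y" "norm Y < 1"
    "(id_blinfun - Y) o\<^sub>L (id_blinfun - Y) = id_blinfun - B"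
proof -
  define X where "X = {Y \<in> commutant S. is_adjoint Y Y} \<inter> cball 0 (norm B)"
  define \<Phi> where "\<Phi> Y = (1/2) *\<^sub>R (B + (Y o\<^sub>L Y))" for Y :: "'a \<Rightarrow>\<^sub>L 'a"
  have "\<exists>!Y. Y \<in> X \<and> \<Phi> Y = Y"
  proof (rule Banach_fix[of _ "norm B"])
    show "complete X"
      unfolding X_def complete_eq_closed
      by (intro closed_Int closed_selfadjoint_commutant closed_cball)
    show "X \<noteq> {}"
      using B by (auto simp: X_def)
    show "\<Phi> ` X \<subseteq> X"
    proof
      fix Z assume "Z \<in> \<Phi> ` X"
      then obtain Y where Y: "Y \<in> commutant S" "is_adjoint Y Y" "norm Y \<le> norm B" and Z: "Z = \<Phi> Y"
        by (auto simp: X_def)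
      have "norm (Y o\<^sub>L Y) \<le> norm B * 1"
        using norm_blinfun_compose[of Y Y] Y(3) B(3)
        by (meson le_less_trans less_imp_le mult_mono norm_ge_zero order_trans)
      then have "norm (B + (Y o\<^sub>L Y)) \<le> 2 * norm B"
        using norm_triangle_ineq[of B "Y o\<^sub>L Y"] by linarith
      then have "norm (\<Phi> Y) \<le> norm B"
        by (simp add: \<Phi>_def)
      moreover have "\<Phi> Y \<in> commutant S"
        unfolding \<Phi>_def by (intro commutant_scaleR commutant_add commutant_compose B Y)
      moreover have "is_adjoint (B + (Y o\<^sub>L Y)) (B + (Y o\<^sub>L Y))"
        by (intro is_adjoint_add is_adjoint_compose B Y)
      then have "is_adjoint (\<Phi> Y) (\<Phi> Y)"
        using \<open>\<Phi> Y \<in> commutant S\<close>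
        by (simp add: \<Phi>_def is_adjoint_iff_inner commutant_cbounded blinfun.scaleR_left is_adjoint_inner)
      ultimately show "Z \<in> X"
        by (simp add: X_def Z)
    qed
    show "dist (\<Phi> Y) (\<Phi> Z) \<le> norm B * dist Y Z" if "Y \<in> X" "Z \<in> X" for Y Z
    proof -
      have YZ: "norm Y \<le> norm B" "norm Z \<le> norm B"
        using that by (auto simp: X_def)
      have "\<Phi> Y - \<Phi> Z = (1/2) *\<^sub>R ((Y o\<^sub>L (Y - Z)) + ((Y - Z) o\<^sub>L Z))"
        by (rule blinfun_eqI) (simp add: \<Phi>_def blinfun.bilinear_simps algebra_simps)
      then have "2 * norm (\<Phi> Y - \<Phi> Z) = norm ((Y o\<^sub>L (Y - Z)) + ((Y - Z) o\<^sub>L Z))"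
        by simp
      also have "\<dots> \<le> norm Y * norm (Y - Z) + norm (Y - Z) * norm Z"
        by (intro norm_triangle_le add_mono norm_blinfun_compose)
      also have "\<dots> \<le> norm B * norm (Y - Z) + norm (Y - Z) * norm B"
        by (intro add_mono mult_left_mono mult_right_mono YZ norm_ge_zero)
      finally show ?thesis
        by (simp add: dist_norm mult.commute)
    qed
  qed (use B in auto)
  then obtain Y where Y: "Y \<in> X" "\<Phi> Y = Y" by blast
  have "2 *\<^sub>R Y = B + (Y o\<^sub>L Y)"
    by (subst Y(2)[symmetric]) (simp add: \<Phi>_def)
  then have *: "blinfun_apply Y (blinfun_apply Y x) = 2 *\<^sub>R blinfun_apply Y x - blinfun_apply B x" for x
    by (metis add_diff_cancel_left' blinfun.add_left blinfun.scaleR_left blinfun_apply_blinfun_compose)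
  have "(id_blinfun - Y) o\<^sub>L (id_blinfun - Y) = id_blinfun - B"
    by (rule blinfun_eqI) (simp add: blinfun.bilinear_simps * scaleR_2)
  then show ?thesis
    using Y(1) B(3) by (intro that[of Y]) (auto simp: X_def)
qed

text \<open>
  The Neumann series, as the fixed point of \<open>Z \<mapsto> I + Y Z\<close>; the fixed point theorem places it in the
  commutant because commutants are norm closed.
\<close>

lemma right_inverse_in_commutant:
  fixes Y :: "'a::chilbert_space \<Rightarrow>\<^sub>L 'a"
  assumes Y: "Y \<in> commutant S" "norm Y < 1"
  obtains Z where "Z \<in> commutant S" "(id_blinfun - Y) o\<^sub>L Z = id_blinfun"
proof -
  have "\<exists>!Z. Z \<in> commutant S \<and> id_blinfun + (Y o\<^sub>L Z) = Z"
  proof (rule Banach_fix[of _ "norm Y"])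
    show "complete (commutant S)"
      unfolding complete_eq_closed by (rule closed_commutant)
    show "commutant S \<noteq> {}"
      using Y by blast
    show "(\<lambda>Z. id_blinfun + (Y o\<^sub>L Z)) ` commutant S \<subseteq> commutant S"
      by (auto intro!: commutant_add commutant_id commutant_compose Y)
    show "dist (id_blinfun + (Y o\<^sub>L Z)) (id_blinfun + (Y o\<^sub>L Z')) \<le> norm Y * dist Z Z'" for Z Z'
    proof -
      have "(id_blinfun + (Y o\<^sub>L Z)) - (id_blinfun + (Y o\<^sub>L Z')) = Y o\<^sub>L (Z - Z')"
        by (rule blinfun_eqI) (simp add: blinfun.bilinear_simps)
      then show ?thesis
        unfolding dist_norm using norm_blinfun_compose[of Y "Z - Z'"] by simp
    qed
  qed (use Y in auto)
  then obtain Z where Z: "Z \<in> commutant S" "id_blinfun + (Y o\<^sub>L Z) = Z" by blast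
  have *: "blinfun_apply Z x = x + blinfun_apply Y (blinfun_apply Z x)" for x
    by (subst Z(2)[symmetric]) (simp add: blinfun.add_left)
  have "(id_blinfun - Y) o\<^sub>L Z = id_blinfun"
    by (rule blinfun_eqI) (simp add: blinfun.diff_left diff_eq_eq *[symmetric])
  then show ?thesis using that Z(1) by blast
qed

text \<open>
  The operator \<open>R\<close> is \<open>(I - B)\<^sup>-\<^sup>1\<^sup>/\<^sup>2\<close>. A right inverse of a self-adjoint operator is automatically
  self-adjoint and two-sided.
\<close>

lemma inverse_square_root_in_commutant:
  fixes B :: "'a::chilbert_space \<Rightarrow>\<^sub>L 'a"
  assumes B: "B \<in> commutant S" "is_adjoint B B" "norm B < 1"
  obtains R where "R \<in> commutant S" "is_adjoint R R"
    "R o\<^sub>L (id_blinfun - B) o\<^sub>L R = id_blinfun"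
proof -
  obtain Y where Y: "Y \<in> commutant S" "is_adjoint Y Y" "norm Y < 1"
    "(id_blinfun - Y) o\<^sub>L (id_blinfun - Y) = id_blinfun - B"
    using square_root_in_commutant[OF B] by blast
  obtain R where R: "R \<in> commutant S" "(id_blinfun - Y) o\<^sub>L R = id_blinfun"
    using right_inverse_in_commutant[OF Y(1,3)] by blast
  define C where "C = id_blinfun - Y"
  have C: "is_adjoint C C"
    unfolding C_def by (intro is_adjoint_diff is_adjoint_id Y)
  have CR: "blinfun_apply C (blinfun_apply R x) = x" for x
    using R(2) unfolding C_def
    by (metis blinfun_apply_blinfun_compose id_blinfun.rep_eq)
  have R_adj: "is_adjoint R R"
    using C CR unfolding is_adjoint_def by metis
  have RC: "blinfun_apply R (blinfun_apply C x) = x" for x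
  proof -
    have "inner (blinfun_apply R (blinfun_apply C x) - x) y = 0" for y
      by (simp add: inner_diff_left is_adjoint_inner[OF R_adj] is_adjoint_inner[OF C] CR)
    then have "blinfun_apply R (blinfun_apply C x) - x = 0"
      by (rule inner_left_zero_imp_zero)
    then show ?thesis by simp
  qed
  have "R o\<^sub>L (id_blinfun - B) o\<^sub>L R = id_blinfun"
    unfolding Y(4)[symmetric] C_def[symmetric] by (rule blinfun_eqI) (simp add: CR RC)
  then show ?thesis using that R(1) R_adj by blast
qed


section \<open>Projections in a von Neumann algebra\<close>

lemma is_orth_proj_fix:
  assumes P: "is_orth_proj L P" and L: "csubspace L" and x: "x \<in> L"
  shows "blinfun_apply P x = x"
proof -
  have "cinner (x - blinfun_apply P x) (x - blinfun_apply P x) = 0"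
    using P x csubspace_diff[OF L x] by (simp add: is_orth_proj_def)
  then have "inner (x - blinfun_apply P x) (x - blinfun_apply P x) = 0"
    by (rule cinner_eq_0_imp_inner)
  then show ?thesis by simp
qed

lemma is_orth_proj_range:
  assumes P: "is_orth_proj L P" and L: "csubspace L"
  shows "range (blinfun_apply P) = L"
proof
  show "range (blinfun_apply P) \<subseteq> L"
    using P by (auto simp: is_orth_proj_def)
  show "L \<subseteq> range (blinfun_apply P)"
    by (auto intro!: range_eqI[where f = "blinfun_apply P"] is_orth_proj_fix[OF P L, symmetric])
qed

lemma is_orth_proj_idem:
  assumes P: "is_orth_proj L P" and L: "csubspace L"
  shows "P o\<^sub>L P = P"
  using is_orth_proj_fix[OF P L] P by (intro blinfun_eqI) (simp add: is_orth_proj_def)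

lemma is_orth_proj_cinner:
  assumes "is_orth_proj L P" "y \<in> L"
  shows "cinner y (blinfun_apply P x) = cinner y x"
proof -
  have "cinner y (x - blinfun_apply P x) = 0"
    using assms by (simp add: is_orth_proj_def)
  then have "cinner y x - cinner y (blinfun_apply P x) = 0"
    by (simp only: cinner_diff_right)
  then show ?thesis
    by (rule right_minus_eq[THEN iffD1, symmetric])
qed

lemma is_orth_proj_selfadjoint:
  assumes P: "is_orth_proj L P"
  shows "is_adjoint P P"
  unfolding is_adjoint_def
proof (intro allI)
  fix x y
  have PL: "blinfun_apply P z \<in> L" for z
    using P by (simp add: is_orth_proj_def)
  have "cinner (blinfun_apply P x) y = cinner (blinfun_apply P x) (blinfun_apply P y)"
    by (rule is_orth_proj_cinner[OF P PL, symmetric])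
  also have "\<dots> = cnj (cinner (blinfun_apply P y) (blinfun_apply P x))"
    by (rule cinner_commute)
  also have "\<dots> = cnj (cinner (blinfun_apply P y) x)"
    by (simp add: is_orth_proj_cinner[OF P PL])
  also have "\<dots> = cinner x (blinfun_apply P y)"
    by (rule cinner_commute[symmetric])
  finally show "cinner (blinfun_apply P x) y = cinner x (blinfun_apply P y)" .
qed

lemma is_orth_proj_cbounded:
  assumes P: "is_orth_proj L P" and L: "csubspace L"
  shows "P \<in> cbounded_ops"
  unfolding cbounded_ops_def
proof (intro CollectI allI)
  fix c x
  define d where "d = blinfun_apply P (c *\<^sub>C x) - c *\<^sub>C blinfun_apply P x"
  have PL: "blinfun_apply P z \<in> L" for z
    using P by (simp add: is_orth_proj_def)
  then have "d \<in> L"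
    unfolding d_def using L by (intro csubspace_diff) (auto simp: csubspace_def)
  then have "cinner d (blinfun_apply P z) = cinner d z" for z
    by (rule is_orth_proj_cinner[OF P])
  then have "cinner d d = 0"
    by (subst (2) d_def) (simp add: cinner_diff_right cinner_scaleC_right)
  then have "inner d d = 0"
    by (rule cinner_eq_0_imp_inner)
  then show "blinfun_apply P (c *\<^sub>C x) = c *\<^sub>C blinfun_apply P x"
    by (simp add: d_def)
qed

lemma csubspace_closure:
  fixes L :: "'a::chilbert_space set"
  assumes "csubspace L"
  shows "csubspace (closure L)"
  unfolding csubspace_def
proof (intro conjI ballI allI)
  show "0 \<in> closure L"
    using assms closure_subset by (auto simp: csubspace_def)
  show "x + y \<in> closure L" if xy: "x \<in> closure L" "y \<in> closure L" for x y
  proof -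
    obtain f where f: "\<forall>n. f n \<in> L" "f \<longlonglongrightarrow> x"
      using xy(1) unfolding closure_sequential by auto
    obtain g where g: "\<forall>n. g n \<in> L" "g \<longlonglongrightarrow> y"
      using xy(2) unfolding closure_sequential by auto
    have "(\<forall>n. f n + g n \<in> L) \<and> (\<lambda>n. f n + g n) \<longlonglongrightarrow> x + y"
      using f g csubspace_add[OF assms] tendsto_add by blast
    then show ?thesis
      unfolding closure_sequential by (intro exI[of _ "\<lambda>n. f n + g n"])
  qed
  show "c *\<^sub>C x \<in> closure L" if "x \<in> closure L" for c x
  proof -
    have "scaleC c ` closure L \<subseteq> closure (scaleC c ` L)"
      by (rule closure_bounded_linear_image_subset[OF bounded_linear_scaleC])
    also have "\<dots> \<subseteq> closure L"
      using assms by (intro closure_mono) (auto simp: csubspace_def)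
    finally show ?thesis using that by blast
  qed
qed

lemma csubspace_range: "T \<in> cbounded_ops \<Longrightarrow> csubspace (range (blinfun_apply T))"
  unfolding csubspace_def cbounded_ops_def
proof (intro conjI ballI allI)
  show "0 \<in> range (blinfun_apply T)"
    using blinfun.zero_right[of T] by (metis rangeI)
  show "x + y \<in> range (blinfun_apply T)" if "x \<in> range (blinfun_apply T)" "y \<in> range (blinfun_apply T)" for x y
    using that by (auto simp flip: blinfun.add_right)
  show "c *\<^sub>C x \<in> range (blinfun_apply T)"
    if "T \<in> {T. \<forall>c x. blinfun_apply T (c *\<^sub>C x) = c *\<^sub>C blinfun_apply T x}" "x \<in> range (blinfun_apply T)" for c x
    using that by (auto simp: eq_commute[of _ "scaleC _ _"])
qed

lemma closed_csubspace_kernel: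
  assumes "T \<in> cbounded_ops"
  shows "closed_csubspace {x. blinfun_apply T x = 0}"
  unfolding closed_csubspace_def
proof
  have "c *\<^sub>C (0 :: 'a) = 0" for c
    by (rule linear_0[OF bounded_linear.linear[OF bounded_linear_scaleC]])
  then show "csubspace {x. blinfun_apply T x = 0}"
    using assms by (auto simp: csubspace_def cbounded_ops_def blinfun.bilinear_simps)
  show "closed {x. blinfun_apply T x = 0}"
    by (intro closed_Collect_eq continuous_intros)
qed

text \<open>
  If \<open>p\<close> is the orthogonal projection of \<open>w\<close> onto the closure of the range of \<open>T'\<close>, then \<open>w - p\<close> is
  orthogonal to that range, hence in the kernel of \<open>T\<close>, hence orthogonal to \<open>w\<close> and to \<open>p\<close>, hence zero.
\<close>

lemma orthogonal_kernel_subset_closure_range: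
  fixes T :: "'a::chilbert_space \<Rightarrow>\<^sub>L 'a"
  assumes T': "T' \<in> cbounded_ops" and adj: "is_adjoint T T'"
    and w: "\<And>z. blinfun_apply T z = 0 \<Longrightarrow> cinner z w = 0"
  shows "w \<in> closure (range (blinfun_apply T'))"
proof -
  let ?R = "closure (range (blinfun_apply T'))"
  have "\<exists>p\<in>?R. \<forall>y\<in>?R. cinner y (w - p) = 0"
    by (rule csubspace_orthogonal_decomposition[of ?R w,
          OF csubspace_closure[OF csubspace_range[OF T']] closed_closure]) blast
  then obtain p where p: "p \<in> ?R" "\<forall>y\<in>?R. cinner y (w - p) = 0" ..
  have "inner (blinfun_apply T (w - p)) y = 0" for y
  proof -
    have "blinfun_apply T' y \<in> ?R"
      by (rule subsetD[OF closure_subset]) simp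
    then have "inner (blinfun_apply T' y) (w - p) = 0"
      using p(2) by (intro cinner_eq_0_imp_inner) blast
    then show ?thesis
      by (simp only: is_adjoint_inner[OF adj] inner_commute[of "w - p"])
  qed
  then have "blinfun_apply T (w - p) = 0"
    by (rule inner_left_zero_imp_zero)
  then have "inner (w - p) w = 0"
    by (intro cinner_eq_0_imp_inner w)
  moreover have "inner p (w - p) = 0"
    using p by (intro cinner_eq_0_imp_inner) blast
  ultimately have "inner (w - p) (w - p) = 0"
    by (simp add: inner_diff_left inner_diff_right inner_commute)
  then show ?thesis
    using p(1) by simp
qed

lemma vN_cbounded: "von_neumann_algebra \<A> \<Longrightarrow> T \<in> \<A> \<Longrightarrow> T \<in> cbounded_ops"
  by (auto simp: von_neumann_algebra_def)

lemma vN_commutant: "von_neumann_algebra \<A> \<Longrightarrow> commutant (commutant \<A>) = \<A>"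
  by (simp add: von_neumann_algebra_def)

lemma vN_id: "von_neumann_algebra \<A> \<Longrightarrow> id_blinfun \<in> \<A>"
  using commutant_id vN_commutant by blast

lemma vN_compose: "von_neumann_algebra \<A> \<Longrightarrow> T \<in> \<A> \<Longrightarrow> U \<in> \<A> \<Longrightarrow> T o\<^sub>L U \<in> \<A>"
  using commutant_compose vN_commutant by blast

lemma vN_add: "von_neumann_algebra \<A> \<Longrightarrow> T \<in> \<A> \<Longrightarrow> U \<in> \<A> \<Longrightarrow> T + U \<in> \<A>"
  using commutant_add vN_commutant by blast

lemma vN_diff: "von_neumann_algebra \<A> \<Longrightarrow> T \<in> \<A> \<Longrightarrow> U \<in> \<A> \<Longrightarrow> T - U \<in> \<A>"
  using commutant_diff vN_commutant by blast

text \<open>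
  By the double commutant property it is enough that \<open>E\<close> commutes with the commutant. An operator \<open>X\<close>
  commuting with \<open>T\<close> and with its adjoint \<open>T'\<close> leaves both the kernel of \<open>T\<close> and the range of \<open>T'\<close>
  invariant, so it respects the orthogonal splitting of the space into the kernel of \<open>T\<close> and the
  closure of the range of \<open>T'\<close>.
\<close>

lemma kernel_projection_in_vN:
  fixes \<A> :: "('a::chilbert_space \<Rightarrow>\<^sub>L 'a) set"
  assumes \<A>: "von_neumann_algebra \<A>" and T: "T \<in> \<A>"
  defines "E \<equiv> orth_proj {x. blinfun_apply T x = 0}"
  shows "E \<in> Proj \<A>" and "range (blinfun_apply E) = {x. blinfun_apply T x = 0}"
proof -
  let ?L = "{x. blinfun_apply T x = 0}"
  have L: "closed_csubspace ?L"
    by (intro closed_csubspace_kernel vN_cbounded[OF \<A> T])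
  then have cL: "csubspace ?L"
    by (simp add: closed_csubspace_def)
  have E: "is_orth_proj ?L E"
    unfolding E_def by (rule is_orth_proj_orth_proj[OF L])
  obtain T' where T': "T' \<in> \<A>" "is_adjoint T T'"
    using \<A> T by (auto simp: von_neumann_algebra_def)
  have "E \<in> commutant (commutant \<A>)"
  proof (rule commutantI)
    show "E \<in> cbounded_ops"
      by (rule is_orth_proj_cbounded[OF E cL])
    fix X x assume X: "X \<in> commutant \<A>"
    \<comment> \<open>The summand \<open>u\<close> stays in the kernel of \<open>T\<close> under \<open>X\<close>, and \<open>w\<close> stays orthogonal to it.\<close>
    define u w where "u = blinfun_apply E x" and "w = x - blinfun_apply E x"
    have u: "blinfun_apply T u = 0"
      using E by (simp add: u_def is_orth_proj_def)
    have "blinfun_apply T (blinfun_apply X u) = 0"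
      using commutant_apply[OF X T, of u] u by simp
    then have EXu: "blinfun_apply E (blinfun_apply X u) = blinfun_apply X u"
      by (intro is_orth_proj_fix[OF E cL]) simp
    have "cinner z w = 0" if "blinfun_apply T z = 0" for z
      using E that by (simp add: w_def is_orth_proj_def)
    then have "w \<in> closure (range (blinfun_apply T'))"
      by (intro orthogonal_kernel_subset_closure_range[OF vN_cbounded[OF \<A> T'(1)] T'(2)])
    moreover have "blinfun_apply X ` closure (range (blinfun_apply T'))
        \<subseteq> closure (blinfun_apply X ` range (blinfun_apply T'))"
      by (rule closure_bounded_linear_image_subset[OF blinfun.bounded_linear_right])
    moreover have "blinfun_apply X ` range (blinfun_apply T') \<subseteq> range (blinfun_apply T')"
      using commutant_apply[OF X T'(1)] by auto
    ultimately have Xw: "blinfun_apply X w \<in> closure (range (blinfun_apply T'))"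
      using closure_mono by blast
    have "blinfun_apply E (blinfun_apply X w) = 0"
    proof -
      have "range (blinfun_apply T') \<subseteq> {y. blinfun_apply E y = 0}"
      proof clarify
        fix y
        have "inner (blinfun_apply E (blinfun_apply T' y)) z = 0" for z
        proof -
          have "blinfun_apply T (blinfun_apply E z) = 0"
            using E by (simp add: is_orth_proj_def)
          then show ?thesis
            using is_adjoint_inner[OF is_orth_proj_selfadjoint[OF E], of "blinfun_apply T' y" z]
              is_adjoint_inner[OF T'(2), of "blinfun_apply E z" y]
            by (simp add: inner_commute)
        qed
        then show "blinfun_apply E (blinfun_apply T' y) = 0"
          by (rule inner_left_zero_imp_zero)
      qed
      moreover have "closed {y. blinfun_apply E y = 0}"
        by (intro closed_Collect_eq continuous_intros)
      ultimately have "closure (range (blinfun_apply T')) \<subseteq> {y. blinfun_apply E y = 0}"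
        by (rule closure_minimal)
      then show ?thesis using Xw by blast
    qed
    moreover have "blinfun_apply X x = blinfun_apply X u + blinfun_apply X w"
      by (simp add: u_def w_def flip: blinfun.add_right)
    ultimately show "blinfun_apply E (blinfun_apply X x) = blinfun_apply X (blinfun_apply E x)"
      using EXu by (simp add: blinfun.add_right flip: u_def)
  qed
  then show "E \<in> Proj \<A>"
    using vN_commutant[OF \<A>] is_orth_proj_idem[OF E cL] is_orth_proj_selfadjoint[OF E]
    by (simp add: Proj_def)
  show "range (blinfun_apply E) = ?L"
    by (rule is_orth_proj_range[OF E cL])
qed


section \<open>Finite projections\<close>

lemma blinfun_compose_eqD:
  "A o\<^sub>L B = C \<Longrightarrow> blinfun_apply A (blinfun_apply B x) = blinfun_apply C x"
  by auto

lemma Proj_apply: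
  assumes "P \<in> Proj \<A>"
  shows Proj_idem: "blinfun_apply P (blinfun_apply P x) = blinfun_apply P x"
    and Proj_inner: "inner (blinfun_apply P x) y = inner x (blinfun_apply P y)"
  using assms is_adjoint_inner[of P P x y] blinfun_compose_eqD[of P P P x]
  by (simp_all add: Proj_def)

lemma adjoint_compose_eq_flip:
  assumes A: "is_adjoint A A'" and B: "is_adjoint B B'" and C: "is_adjoint C C'"
    and eq: "\<And>x. blinfun_apply A (blinfun_apply B x) = blinfun_apply C x"
  shows "blinfun_apply B' (blinfun_apply A' x) = blinfun_apply C' x"
proof -
  have "inner (blinfun_apply B' (blinfun_apply A' x) - blinfun_apply C' x) y = 0" for y
    using is_adjoint_inner[OF is_adjoint_sym[OF A], of x "blinfun_apply B y"]
      is_adjoint_inner[OF is_adjoint_sym[OF B], of "blinfun_apply A' x" y]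
      is_adjoint_inner[OF is_adjoint_sym[OF C], of x y] eq[of y]
    by (simp add: inner_diff_left)
  then have "blinfun_apply B' (blinfun_apply A' x) - blinfun_apply C' x = 0"
    by (rule inner_left_zero_imp_zero)
  then show ?thesis by simp
qed

text \<open>
  The vectors \<open>x - E x\<close> are killed by \<open>U\<close>, because \<open>norm (U v)\<close> squared is the inner product of \<open>v\<close>
  and \<open>E v\<close>, which is zero for such \<open>v\<close>.
\<close>

lemma partial_isometry_initial:
  assumes U: "is_adjoint U U'"
    and U'U: "\<And>x. blinfun_apply U' (blinfun_apply U x) = blinfun_apply E x"
    and EE: "\<And>x. blinfun_apply E (blinfun_apply E x) = blinfun_apply E x"
  shows "blinfun_apply U (blinfun_apply E x) = blinfun_apply U x"
proof -
  define v where "v = blinfun_apply E x - x"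
  have "inner (blinfun_apply U v) (blinfun_apply U v) = inner v (blinfun_apply E v)"
    by (simp add: is_adjoint_inner[OF U] U'U)
  also have "blinfun_apply E v = 0"
    by (simp add: v_def blinfun.diff_right EE)
  finally have "blinfun_apply U v = 0" by simp
  then show ?thesis
    by (simp add: v_def blinfun.diff_right)
qed

text \<open>
  The partial isometry \<open>U\<close> carries \<open>E\<close> to the subprojection \<open>U U'\<close> of \<open>P\<close>. If \<open>V\<close> were an equivalence
  of \<open>E\<close> with a proper subprojection \<open>E'\<close>, its transport \<open>U V U'\<close>, completed by the identity on the
  rest \<open>D\<close> of the range of \<open>P\<close>, would be an equivalence of \<open>P\<close> with a proper subprojection.
\<close>

lemma finite_projection_subequivalent:
  fixes \<A> :: "('a::chilbert_space \<Rightarrow>\<^sub>L 'a) set"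
  assumes \<A>: "von_neumann_algebra \<A>" and P: "P \<in> Proj\<^sub>0 \<A>" and E: "E \<in> Proj \<A>"
    and U: "U \<in> \<A>" "U' \<in> \<A>" "is_adjoint U U'"
    and U'U: "U' o\<^sub>L U = E" and PU: "P o\<^sub>L U = U"
  shows "E \<in> Proj\<^sub>0 \<A>"
proof (rule ccontr)
  assume "E \<notin> Proj\<^sub>0 \<A>"
  then obtain E' V W where E': "E' \<in> Proj \<A>" "range (blinfun_apply E') \<subset> range (blinfun_apply E)"
    and V: "V \<in> \<A>" "W \<in> \<A>" "is_adjoint V W" "W o\<^sub>L V = E" "V o\<^sub>L W = E'"
    using E unfolding Proj\<^sub>0_def proper_subprojection_def mvn_equiv_def by blast
  have P': "P \<in> Proj \<A>"
    using P by (simp add: Proj\<^sub>0_def)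
  have adj: "is_adjoint E E" "is_adjoint E' E'" "is_adjoint P P"
    and mem: "P \<in> \<A>" "E' \<in> \<A>"
    using E E' P' by (auto simp: Proj_def)
  have EE: "blinfun_apply E (blinfun_apply E x) = blinfun_apply E x"
    and E'E': "blinfun_apply E' (blinfun_apply E' x) = blinfun_apply E' x"
    and PP: "blinfun_apply P (blinfun_apply P x) = blinfun_apply P x" for x
    by (rule Proj_idem[OF E] Proj_idem[OF E'(1)] Proj_idem[OF P'])+
  have U'U': "blinfun_apply U' (blinfun_apply U x) = blinfun_apply E x"
    and PU': "blinfun_apply P (blinfun_apply U x) = blinfun_apply U x"
    and WV: "blinfun_apply W (blinfun_apply V x) = blinfun_apply E x"
    and VW: "blinfun_apply V (blinfun_apply W x) = blinfun_apply E' x" for x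
    by (rule blinfun_compose_eqD[OF U'U] blinfun_compose_eqD[OF PU]
        blinfun_compose_eqD[OF V(4)] blinfun_compose_eqD[OF V(5)])+
  have EE': "blinfun_apply E (blinfun_apply E' x) = blinfun_apply E' x" for x
  proof -
    obtain y where "blinfun_apply E' x = blinfun_apply E y"
      using E'(2) by blast
    then show ?thesis by (simp add: EE)
  qed
  have UE: "blinfun_apply U (blinfun_apply E x) = blinfun_apply U x" for x
    by (rule partial_isometry_initial[OF U(3) U'U' EE])
  have VE: "blinfun_apply V (blinfun_apply E x) = blinfun_apply V x" for x
    by (rule partial_isometry_initial[OF V(3) WV EE])
  have EU': "blinfun_apply E (blinfun_apply U' x) = blinfun_apply U' x" for x
    by (rule adjoint_compose_eq_flip[OF U(3) adj(1) U(3) UE])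
  have EW: "blinfun_apply E (blinfun_apply W x) = blinfun_apply W x" for x
    by (rule adjoint_compose_eq_flip[OF V(3) adj(1) V(3) VE])
  have U'P: "blinfun_apply U' (blinfun_apply P x) = blinfun_apply U' x" for x
    by (rule adjoint_compose_eq_flip[OF adj(3) U(3) U(3) PU'])
  have E'E: "blinfun_apply E' (blinfun_apply E x) = blinfun_apply E' x" for x
    by (rule adjoint_compose_eq_flip[OF adj(1,2,2) EE'])
  have EV: "blinfun_apply E (blinfun_apply V x) = blinfun_apply V x" for x
    using EE'[of "blinfun_apply V x"] by (simp add: WV VE flip: VW)
  define D where "D = P - (U o\<^sub>L U')"
  define V1 where "V1 = (U o\<^sub>L V o\<^sub>L U') + D"
  define W1 where "W1 = (U o\<^sub>L W o\<^sub>L U') + D"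
  define P1 where "P1 = (U o\<^sub>L E' o\<^sub>L U') + D"
  note rules = EE E'E' PP U'U' PU' WV VW EE' UE VE EU' EW U'P E'E EV
  have D_mem: "D \<in> \<A>"
    unfolding D_def by (intro vN_diff[OF \<A>] vN_compose[OF \<A>] mem U)
  have D_adj: "is_adjoint D D"
    unfolding D_def by (intro is_adjoint_diff is_adjoint_compose adj U is_adjoint_sym[OF U(3)])
  have V1: "V1 \<in> \<A>" "W1 \<in> \<A>"
    unfolding V1_def W1_def by (intro vN_add[OF \<A>] vN_compose[OF \<A>] D_mem U V)+
  have "is_adjoint (U o\<^sub>L V o\<^sub>L U') (U o\<^sub>L (W o\<^sub>L U'))"
    by (intro is_adjoint_compose U V is_adjoint_sym[OF U(3)])
  then have V1_adj: "is_adjoint V1 W1"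
    unfolding V1_def W1_def by (intro is_adjoint_add D_adj) (simp add: is_adjoint_def)
  have WV1: "W1 o\<^sub>L V1 = P"
    by (rule blinfun_eqI) (simp add: W1_def V1_def D_def blinfun.bilinear_simps rules)
  have VW1: "V1 o\<^sub>L W1 = P1"
    by (rule blinfun_eqI) (simp add: W1_def V1_def P1_def D_def blinfun.bilinear_simps rules)
  have P1: "P1 \<in> Proj \<A>"
    unfolding Proj_def
  proof (intro CollectI conjI)
    show "P1 \<in> \<A>"
      using vN_compose[OF \<A> V1] by (simp add: VW1)
    show "P1 o\<^sub>L P1 = P1"
      by (rule blinfun_eqI) (simp add: P1_def D_def blinfun.bilinear_simps rules)
    show "is_adjoint P1 P1"
      using is_adjoint_compose[OF V1_adj is_adjoint_sym[OF V1_adj]] by (simp add: VW1)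
  qed
  have "range (blinfun_apply P1) \<subseteq> range (blinfun_apply P)"
  proof clarify
    fix x
    have "blinfun_apply P1 x = blinfun_apply P (blinfun_apply P1 x)"
      by (simp add: P1_def D_def blinfun.bilinear_simps rules)
    then show "blinfun_apply P1 x \<in> range (blinfun_apply P)"
      by (rule range_eqI)
  qed
  moreover have "\<not> range (blinfun_apply P) \<subseteq> range (blinfun_apply P1)"
  proof
    assume sub: "range (blinfun_apply P) \<subseteq> range (blinfun_apply P1)"
    obtain x where x: "blinfun_apply E x \<notin> range (blinfun_apply E')"
      using E'(2) by blast
    have "blinfun_apply U x \<in> range (blinfun_apply P)"
      using PU'[of x] by (metis rangeI)
    then obtain z where "blinfun_apply U x = blinfun_apply P1 z"
      using sub by blast
    then have "blinfun_apply U' (blinfun_apply U x) = blinfun_apply U' (blinfun_apply P1 z)"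
      by simp
    then have "blinfun_apply E x = blinfun_apply E' (blinfun_apply U' z)"
      by (simp add: P1_def D_def blinfun.bilinear_simps rules)
    then show False using x by blast
  qed
  ultimately have "proper_subprojection P1 P"
    unfolding proper_subprojection_def by blast
  moreover have "mvn_equiv \<A> P P1"
    unfolding mvn_equiv_def using V1 V1_adj WV1 VW1 by blast
  ultimately show False
    using P P1 unfolding Proj\<^sub>0_def by blast
qed

text \<open>
  Polar decomposition of \<open>P E\<close>. On the range of \<open>E\<close>, \<open>E P E\<close> is \<open>I - B\<close> with
  \<open>B = E (I - P) E\<close>, and the lower bound for \<open>P\<close> says, by Pythagoras, that \<open>norm B < 1\<close>. If
  \<open>R = (I - B)\<^sup>-\<^sup>1\<^sup>/\<^sup>2\<close> commutes with \<open>E\<close>, then \<open>P R E\<close> is a partial isometry from \<open>E\<close> into \<open>P\<close>.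
\<close>

lemma finite_projection_bounded_below:
  fixes \<A> :: "('a::chilbert_space \<Rightarrow>\<^sub>L 'a) set"
  assumes \<A>: "von_neumann_algebra \<A>" and P: "P \<in> Proj\<^sub>0 \<A>" and E: "E \<in> Proj \<A>"
    and c: "0 < c" "\<And>x. c * norm (blinfun_apply E x) \<le> norm (blinfun_apply P (blinfun_apply E x))"
  shows "E \<in> Proj\<^sub>0 \<A>"
proof -
  have P': "P \<in> Proj \<A>"
    using P by (simp add: Proj\<^sub>0_def)
  have adj: "is_adjoint E E" "is_adjoint P P" and mem: "P \<in> \<A>" "E \<in> \<A>"
    using E P' by (auto simp: Proj_def)
  note idem = Proj_idem[OF E] Proj_idem[OF P']
  define Q where "Q = id_blinfun - P"
  define B where "B = E o\<^sub>L (Q o\<^sub>L E)"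
  \<comment> \<open>The minimum keeps the argument of the root nonnegative: \<open>c\<close> may exceed 1 when \<open>E = 0\<close>.\<close>
  define q where "q = sqrt (1 - (min c 1)\<^sup>2)"
  have q: "0 \<le> q" "q < 1" "q\<^sup>2 = 1 - (min c 1)\<^sup>2"
    using c(1) by (auto simp: q_def abs_square_le_1 power_le_one)
  have contr: "norm (blinfun_apply E x) \<le> norm x" for x
  proof (cases "blinfun_apply E x = 0")
    case False
    have "(norm (blinfun_apply E x))\<^sup>2 = inner x (blinfun_apply E x)"
      by (simp add: power2_norm_eq_inner Proj_inner[OF E] idem)
    also have "\<dots> \<le> norm x * norm (blinfun_apply E x)"
      by (rule norm_cauchy_schwarz)
    finally show ?thesis
      using False by (simp add: power2_eq_square)
  qed simp
  \<comment> \<open>Adding \<open>E\<close> to the operators that have to be commuted with keeps the inverse square root in the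
    algebra and makes it commute with \<open>E\<close>.\<close>
  have B_mem: "B \<in> commutant (commutant \<A> \<union> {E})"
  proof (rule commutantI)
    have B\<A>: "B \<in> \<A>"
      unfolding B_def Q_def by (intro vN_compose[OF \<A>] vN_diff[OF \<A>] vN_id[OF \<A>] mem)
    then show "B \<in> cbounded_ops"
      by (rule vN_cbounded[OF \<A>])
    fix A x assume "A \<in> commutant \<A> \<union> {E}"
    then show "blinfun_apply B (blinfun_apply A x) = blinfun_apply A (blinfun_apply B x)"
      using commutant_apply[of A \<A> B x] B\<A> by (auto simp: B_def idem)
  qed
  have B_adj: "is_adjoint B B"
  proof -
    have "is_adjoint B ((E o\<^sub>L Q) o\<^sub>L E)"
      unfolding B_def Q_def by (intro is_adjoint_compose is_adjoint_diff is_adjoint_id adj)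
    then show ?thesis
      by (simp add: B_def is_adjoint_def)
  qed
  have "norm B \<le> q"
  proof (rule norm_blinfun_bound[OF q(1)])
    fix x
    define e where "e = blinfun_apply E x"
    have "(min c 1)\<^sup>2 * (norm e)\<^sup>2 \<le> (norm (blinfun_apply P e))\<^sup>2"
    proof -
      have "min c 1 * norm e \<le> c * norm e"
        by (intro mult_right_mono) auto
      then have "min c 1 * norm e \<le> norm (blinfun_apply P e)"
        using c(2)[of x] by (simp add: e_def)
      then have "(min c 1 * norm e)\<^sup>2 \<le> (norm (blinfun_apply P e))\<^sup>2"
        using c(1) by (intro power_mono) auto
      then show ?thesis by (simp add: power_mult_distrib)
    qed
    moreover have "(norm (blinfun_apply Q e))\<^sup>2 = (norm e)\<^sup>2 - (norm (blinfun_apply P e))\<^sup>2"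
      unfolding power2_norm_eq_inner
      by (simp add: Q_def blinfun.diff_left inner_diff_left inner_diff_right Proj_inner[OF P'] idem)
    ultimately have "(norm (blinfun_apply Q e))\<^sup>2 \<le> (q * norm e)\<^sup>2"
      by (simp add: power_mult_distrib q(3) algebra_simps)
    then have "norm (blinfun_apply Q e) \<le> q * norm e"
      by (rule power2_le_imp_le) (simp add: q(1))
    moreover have "norm (blinfun_apply B x) \<le> norm (blinfun_apply Q e)"
      using contr[of "blinfun_apply Q e"] by (simp add: B_def e_def)
    moreover have "q * norm e \<le> q * norm x"
      using contr[of x] q(1) by (intro mult_left_mono) (simp_all add: e_def)
    ultimately show "norm (blinfun_apply B x) \<le> q * norm x"
      by linarith
  qed
  then have "norm B < 1"
    using q(2) by simp
  then obtain R where R: "R \<in> commutant (commutant \<A> \<union> {E})" "is_adjoint R R"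
    "R o\<^sub>L (id_blinfun - B) o\<^sub>L R = id_blinfun"
    using inverse_square_root_in_commutant[OF B_mem B_adj] by blast
  have R_mem: "R \<in> \<A>"
  proof -
    have "R \<in> commutant (commutant \<A>)"
      using R(1) by (simp add: commutant_def)
    then show ?thesis by (simp add: vN_commutant[OF \<A>])
  qed
  have RE: "blinfun_apply R (blinfun_apply E x) = blinfun_apply E (blinfun_apply R x)" for x
    by (rule commutant_apply[OF R(1)]) simp
  have RBR: "blinfun_apply R (blinfun_apply R x - blinfun_apply B (blinfun_apply R x)) = x" for x
  proof -
    have "blinfun_apply (R o\<^sub>L (id_blinfun - B) o\<^sub>L R) x = x"
      by (simp only: R(3)) simp
    then show ?thesis
      by (simp add: blinfun.diff_left)
  qed
  show ?thesis
  proof (rule finite_projection_subequivalent[OF \<A> P E])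
    show "P o\<^sub>L (R o\<^sub>L E) \<in> \<A>" "(E o\<^sub>L R) o\<^sub>L P \<in> \<A>"
      by (intro vN_compose[OF \<A>] mem R_mem)+
    show "is_adjoint (P o\<^sub>L (R o\<^sub>L E)) ((E o\<^sub>L R) o\<^sub>L P)"
      by (intro is_adjoint_compose adj R(2))
    show "P o\<^sub>L (P o\<^sub>L (R o\<^sub>L E)) = P o\<^sub>L (R o\<^sub>L E)"
      by (rule blinfun_eqI) (simp add: idem)
    show "((E o\<^sub>L R) o\<^sub>L P) o\<^sub>L (P o\<^sub>L (R o\<^sub>L E)) = E"
    proof (rule blinfun_eqI)
      fix x
      define y where "y = blinfun_apply R (blinfun_apply E x)"
      have Ey: "blinfun_apply E y = y"
        by (simp add: y_def RE idem)
      have "y - blinfun_apply B y = blinfun_apply E (blinfun_apply P y)"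
        by (simp add: B_def Q_def Ey blinfun.bilinear_simps)
      then have "blinfun_apply R (blinfun_apply E (blinfun_apply P y)) = blinfun_apply E x"
        using RBR[of "blinfun_apply E x"] by (simp add: y_def)
      then show "blinfun_apply (((E o\<^sub>L R) o\<^sub>L P) o\<^sub>L (P o\<^sub>L (R o\<^sub>L E))) x = blinfun_apply E x"
        by (simp add: idem flip: y_def RE)
    qed
  qed
qed

corollary finite_subprojection:
  fixes \<A> :: "('a::chilbert_space \<Rightarrow>\<^sub>L 'a) set"
  assumes \<A>: "von_neumann_algebra \<A>" and P: "P \<in> Proj\<^sub>0 \<A>" and E: "E \<in> Proj \<A>"
    and sub: "range (blinfun_apply E) \<subseteq> range (blinfun_apply P)"
  shows "E \<in> Proj\<^sub>0 \<A>"
proof (rule finite_projection_bounded_below[OF \<A> P E, of 1])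
  fix x
  obtain y where "blinfun_apply E x = blinfun_apply P y"
    using sub by blast
  moreover have "P \<in> Proj \<A>"
    using P by (simp add: Proj\<^sub>0_def)
  ultimately show "1 * norm (blinfun_apply E x) \<le> norm (blinfun_apply P (blinfun_apply E x))"
    by (simp add: Proj_idem)
qed simp


section \<open>Operators that are invertible modulo a finite invariant subspace\<close>

text \<open>
  The hypotheses say that \<open>F\<close> preserves the range of \<open>P\<close> and induces a bijection of the quotient. Then
  \<open>Q F Q + P\<close> is bijective on the whole space, where the bounded inverse theorem applies to it.
\<close>

lemma compression_bounded_below:
  fixes F P :: "'a::banach \<Rightarrow>\<^sub>L 'a"
  defines "Q \<equiv> id_blinfun - P"
  assumes PP: "\<And>x. blinfun_apply P (blinfun_apply P x) = blinfun_apply P x"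
    and inv: "\<And>x. blinfun_apply Q (blinfun_apply F (blinfun_apply P x)) = 0"
    and inj: "\<And>x. blinfun_apply Q (blinfun_apply F x) = 0 \<Longrightarrow> blinfun_apply Q x = 0"
    and surj: "\<And>y. \<exists>x. blinfun_apply Q (blinfun_apply F x) = blinfun_apply Q y"
  obtains c where "0 < c"
    "\<And>x. c * norm (blinfun_apply Q x) \<le> norm (blinfun_apply Q (blinfun_apply F (blinfun_apply Q x)))"
    "\<And>y. \<exists>x. blinfun_apply Q (blinfun_apply F (blinfun_apply Q x)) = blinfun_apply Q y"
proof -
  define D where "D = (Q o\<^sub>L F o\<^sub>L Q) + P"
  have Q: "blinfun_apply Q x = x - blinfun_apply P x" for x
    by (simp add: Q_def blinfun.diff_left)
  have PQ: "blinfun_apply P (blinfun_apply Q x) = 0" for x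
    by (simp add: Q blinfun.diff_right PP)
  have QP: "blinfun_apply Q (blinfun_apply P x) = 0" for x
    by (simp add: Q PP)
  have QQ: "blinfun_apply Q (blinfun_apply Q x) = blinfun_apply Q x" for x
    using PQ[of x] by (simp add: Q[of "blinfun_apply Q x"])
  have D: "blinfun_apply D x = blinfun_apply Q (blinfun_apply F (blinfun_apply Q x)) + blinfun_apply P x" for x
    by (simp add: D_def blinfun.add_left)
  have QFQ: "blinfun_apply Q (blinfun_apply F (blinfun_apply Q x)) = blinfun_apply Q (blinfun_apply F x)" for x
    by (simp add: Q[of x] blinfun.diff_right inv)
  have QFQ_surj: "\<exists>x. blinfun_apply Q (blinfun_apply F (blinfun_apply Q x)) = blinfun_apply Q y" for y
    using surj[of y] by (simp only: QFQ)
  have "inj (blinfun_apply D)"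
  proof (rule injI)
    fix x y assume "blinfun_apply D x = blinfun_apply D y"
    then have D0: "blinfun_apply D (x - y) = 0"
      by (simp add: blinfun.diff_right)
    then have P0: "blinfun_apply P (blinfun_apply D (x - y)) = 0"
      by (simp add: blinfun.zero_right)
    have P0: "blinfun_apply P (x - y) = 0"
      using P0 unfolding D by (simp only: blinfun.add_right PQ PP add_0)
    then have "blinfun_apply Q (blinfun_apply F (x - y)) = 0"
      using D0 unfolding D by (simp only: QFQ add_0_right)
    then have "blinfun_apply Q (x - y) = 0"
      by (rule inj)
    then show "x = y"
      using P0 by (simp add: Q)
  qed
  moreover have "surj (blinfun_apply D)"
    unfolding surj_def
  proof
    fix y
    obtain x where x: "blinfun_apply Q (blinfun_apply F (blinfun_apply Q x)) = blinfun_apply Q y"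
      using QFQ_surj by blast
    have "blinfun_apply D (blinfun_apply Q x + blinfun_apply P y) = blinfun_apply Q y + blinfun_apply P y"
      unfolding D by (simp only: blinfun.add_right QQ QP PQ PP x blinfun.zero_right add_0 add_0_right)
    also have "\<dots> = y" by (simp add: Q)
    finally show "\<exists>z. y = blinfun_apply D z" by metis
  qed
  ultimately obtain c where c: "0 < c" "\<And>x. c * norm x \<le> norm (blinfun_apply D x)"
    using bounded_inverse by blast
  show ?thesis
  proof (rule that[OF c(1) _ QFQ_surj])
    show "c * norm (blinfun_apply Q x) \<le> norm (blinfun_apply Q (blinfun_apply F (blinfun_apply Q x)))" for x
      using c(2)[of "blinfun_apply Q x"] unfolding D by (simp only: QQ PQ add_0_right)
  qed
qed

text \<open>
  The projection required for the range is \<open>E\<close>, the one onto the orthogonal complement of the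
  image of \<open>F Q\<close>, where \<open>Q = I - P\<close>. Modulo the range of \<open>P\<close> nothing of the range of \<open>F\<close> is lost by
  restricting \<open>F\<close> to the range of \<open>Q\<close>, and the restriction has closed image.
\<close>

theorem Fredholm_if_bijective_modulo_finite:
  fixes \<A> :: "('a::chilbert_space \<Rightarrow>\<^sub>L 'a) set"
  assumes \<A>: "von_neumann_algebra \<A>" and F: "F \<in> \<A>" and P: "P \<in> Proj\<^sub>0 \<A>"
    and inv: "\<And>x. blinfun_apply (id_blinfun - P) (blinfun_apply F (blinfun_apply P x)) = 0"
    and inj: "\<And>x. blinfun_apply (id_blinfun - P) (blinfun_apply F x) = 0 \<Longrightarrow> blinfun_apply (id_blinfun - P) x = 0"
    and surj: "\<And>y. \<exists>x. blinfun_apply (id_blinfun - P) (blinfun_apply F x) = blinfun_apply (id_blinfun - P) y"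
  shows "Fredholm \<A> F"
proof -
  define Q where "Q = id_blinfun - P"
  have P': "P \<in> Proj \<A>"
    using P by (simp add: Proj\<^sub>0_def)
  then have P_mem: "P \<in> \<A>" and P_adj: "is_adjoint P P"
    by (auto simp: Proj_def)
  have Q: "blinfun_apply Q x = x - blinfun_apply P x" for x
    by (simp add: Q_def blinfun.diff_left)
  have Q_mem: "Q \<in> \<A>"
    unfolding Q_def by (intro vN_diff[OF \<A>] vN_id[OF \<A>] P_mem)
  have Q_adj: "is_adjoint Q Q"
    unfolding Q_def by (intro is_adjoint_diff is_adjoint_id P_adj)
  have QQ: "blinfun_apply Q (blinfun_apply Q x) = blinfun_apply Q x" for x
    by (simp add: Q blinfun.diff_right Proj_idem[OF P'])
  obtain c where c: "0 < c"
    "\<And>x. c * norm (blinfun_apply Q x) \<le> norm (blinfun_apply Q (blinfun_apply F (blinfun_apply Q x)))"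
    "\<And>y. \<exists>x. blinfun_apply Q (blinfun_apply F (blinfun_apply Q x)) = blinfun_apply Q y"
    using compression_bounded_below[OF Proj_idem[OF P'] inv inj surj]
    unfolding Q_def by metis
  obtain F' where F': "F' \<in> \<A>" "is_adjoint F F'"
    using \<A> F by (auto simp: von_neumann_algebra_def)

  have "orth_proj {x. blinfun_apply F x = 0} \<in> Proj\<^sub>0 \<A>"
  proof (rule finite_subprojection[OF \<A> P kernel_projection_in_vN(1)[OF \<A> F]])
    show "range (blinfun_apply (orth_proj {x. blinfun_apply F x = 0})) \<subseteq> range (blinfun_apply P)"
      unfolding kernel_projection_in_vN(2)[OF \<A> F]
    proof clarify
      fix x assume "blinfun_apply F x = 0"
      then have "x = blinfun_apply P x"
        using inj[of x] by (simp add: blinfun.diff_left blinfun.zero_right)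
      then show "x \<in> range (blinfun_apply P)"
        by (rule range_eqI)
    qed
  qed

  moreover have "\<exists>E \<in> Proj\<^sub>0 \<A>. range (blinfun_apply (id_blinfun - E)) \<subseteq> range (blinfun_apply F)"
  proof
    \<comment> \<open>The range of \<open>I - E\<close> will be the image of \<open>F Q\<close>, whose orthogonal complement is the kernel of
      the adjoint \<open>Q F'\<close>.\<close>
    define T where "T = Q o\<^sub>L F'"
    define E where "E = orth_proj {x. blinfun_apply T x = 0}"
    have T: "T \<in> \<A>"
      unfolding T_def by (intro vN_compose[OF \<A>] Q_mem F')
    have T_adj: "is_adjoint T (F o\<^sub>L Q)"
      unfolding T_def by (intro is_adjoint_compose Q_adj is_adjoint_sym[OF F'(2)])
    note E = kernel_projection_in_vN[OF \<A> T, folded E_def]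
    show "E \<in> Proj\<^sub>0 \<A>"
    proof (rule finite_projection_bounded_below[OF \<A> P E(1)])
      show "0 < 1 / (1 + norm F / c)"
        using c(1) by (intro divide_pos_pos add_pos_nonneg) auto
      fix z
      define y where "y = blinfun_apply E z"
      have Ty: "blinfun_apply T y = 0"
        using E(2) unfolding y_def by blast
      \<comment> \<open>The graph \<open>{F q}\<close>, \<open>q\<close> in the range of \<open>Q\<close>, has a point \<open>w\<close> above \<open>Q y\<close>, and its norm is
        controlled by that of \<open>Q y\<close>.\<close>
      obtain x where x: "blinfun_apply Q (blinfun_apply F (blinfun_apply Q x)) = blinfun_apply Q y"
        using c(3) by blast
      define w where "w = blinfun_apply F (blinfun_apply Q x)"
      have w: "c * norm w \<le> norm F * norm (blinfun_apply Q y)"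
      proof -
        have "c * norm w \<le> c * (norm F * norm (blinfun_apply Q x))"
          unfolding w_def using c(1) norm_blinfun[of F] by (intro mult_left_mono) auto
        also have "\<dots> \<le> norm F * norm (blinfun_apply Q y)"
          using mult_left_mono[OF c(2)[of x], of "norm F"] by (simp add: x mult.left_commute)
        finally show ?thesis .
      qed
      \<comment> \<open>Since \<open>y\<close> is orthogonal to \<open>w = P w + Q y\<close>, the part \<open>Q y\<close> cannot be large unless \<open>P y\<close> is.\<close>
      have "inner y w = 0"
        using is_adjoint_inner[OF T_adj, of y x] Ty by (simp add: w_def)
      moreover have "w = blinfun_apply P w + blinfun_apply Q y"
        using x by (simp add: w_def Q[of "blinfun_apply F (blinfun_apply Q x)"] algebra_simps)
      ultimately have "inner y (blinfun_apply Q y) = - inner y (blinfun_apply P w)"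
        by (metis add.commute inner_add_right add_eq_0_iff)
      moreover have "inner y (blinfun_apply Q y) = (norm (blinfun_apply Q y))\<^sup>2"
        unfolding power2_norm_eq_inner by (simp add: is_adjoint_inner[OF Q_adj] QQ)
      moreover have "inner y (blinfun_apply P w) = inner (blinfun_apply P y) w"
        by (simp add: Proj_inner[OF P'])
      ultimately have sq: "(norm (blinfun_apply Q y))\<^sup>2 \<le> norm (blinfun_apply P y) * norm w"
        using norm_cauchy_schwarz[of "- blinfun_apply P y" w] by simp
      have "c * norm (blinfun_apply Q y) \<le> norm F * norm (blinfun_apply P y)"
      proof (cases "blinfun_apply Q y = 0")
        case False
        have "c * (norm (blinfun_apply Q y))\<^sup>2 \<le> c * (norm (blinfun_apply P y) * norm w)"
          using sq c(1) by (intro mult_left_mono) auto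
        also have "\<dots> = norm (blinfun_apply P y) * (c * norm w)"
          by simp
        also have "\<dots> \<le> norm (blinfun_apply P y) * (norm F * norm (blinfun_apply Q y))"
          using w by (intro mult_left_mono) auto
        finally have "norm (blinfun_apply Q y) * (c * norm (blinfun_apply Q y))
            \<le> norm (blinfun_apply Q y) * (norm F * norm (blinfun_apply P y))"
          by (simp add: power2_eq_square mult_ac)
        then show ?thesis
          using False by (simp add: mult_le_cancel_left_pos)
      qed simp
      then have "norm (blinfun_apply Q y) \<le> norm F / c * norm (blinfun_apply P y)"
        using c(1) by (simp add: field_simps)
      moreover have "norm y \<le> norm (blinfun_apply P y) + norm (blinfun_apply Q y)"
        using norm_triangle_ineq[of "blinfun_apply P y" "blinfun_apply Q y"] by (simp add: Q)
      ultimately have le: "norm y \<le> (1 + norm F / c) * norm (blinfun_apply P y)"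
        unfolding distrib_right by simp
      moreover have "0 < 1 + norm F / c"
        using c(1) by (intro add_pos_nonneg) auto
      ultimately show "1 / (1 + norm F / c) * norm (blinfun_apply E z)
          \<le> norm (blinfun_apply P (blinfun_apply E z))"
        unfolding y_def[symmetric] by (simp add: pos_divide_le_eq mult.commute)
    qed

    \<comment> \<open>Without closedness of this image, \<open>I - E\<close> would only map into its closure.\<close>
    have complete: "complete (blinfun_apply F ` range (blinfun_apply Q))"
    proof (rule complete_isometric_image)
      have norm_Q: "norm (blinfun_apply Q v) \<le> (norm Q + 1) * norm v" for v
        using norm_blinfun[of Q v] by (simp add: distrib_right add_increasing2)
      show "0 < c / (norm Q + 1)"
        using c(1) by (intro divide_pos_pos add_nonneg_pos) auto
      show "subspace (range (blinfun_apply Q))"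
        by (intro linear_subspace_image subspace_UNIV bounded_linear.linear blinfun.bounded_linear_right)
      show "bounded_linear (blinfun_apply F)"
        by (rule blinfun.bounded_linear_right)
      have "range (blinfun_apply Q) = {x. blinfun_apply Q x = x}"
        using QQ by (auto intro: range_eqI[where f = "blinfun_apply Q", OF sym])
      moreover have "closed {x. blinfun_apply Q x = x}"
        by (intro closed_Collect_eq continuous_intros)
      ultimately show "complete (range (blinfun_apply Q))"
        by (simp add: complete_eq_closed)
      show "\<forall>x\<in>range (blinfun_apply Q). norm (blinfun_apply F x) \<ge> c / (norm Q + 1) * norm x"
      proof clarify
        fix x
        have "c * norm (blinfun_apply Q x) \<le> (norm Q + 1) * norm (blinfun_apply F (blinfun_apply Q x))"
          using c(2)[of x] norm_Q order_trans by blast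
        then show "norm (blinfun_apply F (blinfun_apply Q x)) \<ge> c / (norm Q + 1) * norm (blinfun_apply Q x)"
          by (simp add: divide_le_eq add_nonneg_pos mult.commute)
      qed
    qed
    show "range (blinfun_apply (id_blinfun - E)) \<subseteq> range (blinfun_apply F)"
    proof clarify
      fix x
      have E_proj: "is_orth_proj {x. blinfun_apply T x = 0} E"
        unfolding E_def by (intro is_orth_proj_orth_proj closed_csubspace_kernel vN_cbounded[OF \<A> T])
      have "blinfun_apply (id_blinfun - E) x \<in> closure (range (blinfun_apply (F o\<^sub>L Q)))"
      proof (rule orthogonal_kernel_subset_closure_range[OF _ T_adj])
        show "F o\<^sub>L Q \<in> cbounded_ops"
          by (intro vN_cbounded[OF \<A>] vN_compose[OF \<A>] F Q_mem)
        show "cinner z (blinfun_apply (id_blinfun - E) x) = 0" if "blinfun_apply T z = 0" for z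
          using E_proj that by (simp add: is_orth_proj_def blinfun.diff_left)
      qed
      also have "range (blinfun_apply (F o\<^sub>L Q)) = blinfun_apply F ` range (blinfun_apply Q)"
        by auto
      also have "closure \<dots> = \<dots>"
        using complete by (simp add: complete_eq_closed)
      finally show "blinfun_apply (id_blinfun - E) x \<in> range (blinfun_apply F)"
        by blast
    qed
  qed
  ultimately show ?thesis
    unfolding Fredholm_def using F by blast
qed

text \<open>
  All that is kept of a diagonal matrix with bijective first entry: \<open>F\<close> acts on the quotient by \<open>N\<close>,
  and it acts there bijectively, since the quotient is a copy of \<open>M\<close>.
\<close>

lemma diagonal_matrix_bijective_modulo:
  fixes F :: "'a::chilbert_space \<Rightarrow>\<^sub>L 'a"
  assumes sum: "topological_direct_sum M N" and diag: "has_diagonal_matrix F M N F1 F4"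
    and bij: "bij_betw F1 M M"
  shows diagonal_matrix_invariant: "x \<in> N \<Longrightarrow> blinfun_apply F x \<in> N"
    and diagonal_matrix_reflects: "blinfun_apply F x \<in> N \<Longrightarrow> x \<in> N"
    and diagonal_matrix_surj: "\<exists>x. y - blinfun_apply F x \<in> N"
proof -
  have cM: "csubspace M" and cN: "csubspace N" and MN: "\<And>z. z \<in> M \<Longrightarrow> z \<in> N \<Longrightarrow> z = 0"
    and UN: "{m + n |m n. m \<in> M \<and> n \<in> N} = UNIV"
    using sum by (auto simp: topological_direct_sum_def closed_csubspace_def)
  have zero: "0 \<in> M" "0 \<in> N"
    using cM cN by (auto simp: csubspace_def)
  have F1: "\<And>m. m \<in> M \<Longrightarrow> F1 m \<in> M" and F4: "\<And>n. n \<in> N \<Longrightarrow> F4 n \<in> N"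
    and F: "\<And>m n. m \<in> M \<Longrightarrow> n \<in> N \<Longrightarrow> blinfun_apply F (m + n) = F1 m + F4 n"
    using diag by (auto simp: has_diagonal_matrix_def)
  have split: "\<exists>m\<in>M. \<exists>n\<in>N. z = m + n" for z
    using UN by blast
  have "F1 0 + F4 0 = 0"
    using F[OF zero] by (simp add: blinfun.zero_right)
  then have F1_0_eq: "F1 0 = 0 - F4 0"
    by (simp add: eq_neg_iff_add_eq_0)
  have "F1 0 \<in> N"
    unfolding F1_0_eq by (intro csubspace_diff[OF cN] zero F4)
  then have F1_0: "F1 0 = 0"
    by (rule MN[OF F1[OF zero(1)]])
  then have F4_0: "F4 0 = 0"
    using F1_0_eq by simp
  show "blinfun_apply F x \<in> N" if "x \<in> N"
    using F[OF zero(1) that] F4[OF that] by (simp add: F1_0)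
  show "x \<in> N" if Fx: "blinfun_apply F x \<in> N"
  proof -
    obtain m n where mn: "m \<in> M" "n \<in> N" "x = m + n"
      using split by blast
    have "F1 m = blinfun_apply F x - F4 n"
      using F mn by simp
    then have "F1 m \<in> N"
      using csubspace_diff[OF cN Fx F4[OF mn(2)]] by simp
    then have "F1 m = F1 0"
      unfolding F1_0 by (rule MN[OF F1[OF mn(1)]])
    then have "m = 0"
      using bij mn(1) zero(1) by (auto simp: bij_betw_def inj_on_def)
    then show ?thesis using mn by simp
  qed
  show "\<exists>x. y - blinfun_apply F x \<in> N"
  proof -
    obtain m' n where y: "m' \<in> M" "n \<in> N" "y = m' + n"
      using split by blast
    obtain m where m: "m \<in> M" "F1 m = m'"
      using bij y(1) by (metis bij_betw_imp_surj_on imageE)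
    have "y - blinfun_apply F m = n"
      using F[OF m(1) zero(2)] y(3) by (simp add: m(2) F4_0)
    then show ?thesis using y(2) by blast
  qed
qed

theorem lemma4p6:
  fixes \<A> :: "('a::chilbert_space \<Rightarrow>\<^sub>L 'a) set"
    and F :: "'a \<Rightarrow>\<^sub>L 'a"
  assumes "von_neumann_algebra \<A>"
    and "properly_infinite \<A>"
    and "F \<in> \<A>"
    and "generalized_Browder \<A> F"
  shows "Fredholm \<A> F"
proof -
  obtain M N F1 F4 G where sum: "topological_direct_sum M N"
    and diag: "has_diagonal_matrix F M N F1 F4"
    and homeo: "homeomorphism M M F1 G" and P: "orth_proj N \<in> Proj\<^sub>0 \<A>"
    using assms(4) unfolding generalized_Browder_def by blast
  have bij: "bij_betw F1 M M"
    using homeo by (auto simp: homeomorphism_def bij_betw_def intro: inj_on_inverseI)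
  define P where "P = orth_proj N"
  have N: "csubspace N" and P_proj: "is_orth_proj N P"
    using sum is_orth_proj_orth_proj
    by (auto simp: topological_direct_sum_def closed_csubspace_def P_def)
  have off_N: "blinfun_apply (id_blinfun - P) x = 0 \<longleftrightarrow> x \<in> N" for x
  proof -
    have "blinfun_apply P x \<in> N"
      using P_proj by (simp add: is_orth_proj_def)
    then show ?thesis
      using is_orth_proj_fix[OF P_proj N, of x] by (auto simp: blinfun.diff_left)
  qed
  show ?thesis
  proof (rule Fredholm_if_bijective_modulo_finite[OF assms(1,3) P[folded P_def]])
    show "blinfun_apply (id_blinfun - P) (blinfun_apply F (blinfun_apply P x)) = 0" for x
      using P_proj unfolding off_N
      by (intro diagonal_matrix_invariant[OF sum diag bij]) (simp add: is_orth_proj_def)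
    show "blinfun_apply (id_blinfun - P) x = 0"
      if "blinfun_apply (id_blinfun - P) (blinfun_apply F x) = 0" for x
      using that unfolding off_N by (rule diagonal_matrix_reflects[OF sum diag bij])
    show "\<exists>x. blinfun_apply (id_blinfun - P) (blinfun_apply F x) = blinfun_apply (id_blinfun - P) y" for y
    proof -
      obtain x where "y - blinfun_apply F x \<in> N"
        using diagonal_matrix_surj[OF sum diag bij] by blast
      then have "blinfun_apply (id_blinfun - P) (y - blinfun_apply F x) = 0"
        by (simp only: off_N)
      then have "blinfun_apply (id_blinfun - P) y
          - blinfun_apply (id_blinfun - P) (blinfun_apply F x) = 0"
        by (simp only: blinfun.diff_right)
      then show ?thesis
        by (intro exI[of _ x]) (rule right_minus_eq[THEN iffD1, symmetric])
    qed
  qed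
qed

end
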